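(* Let us consider the differential equation $${}^{ABC}\mathbf{D}_{0+}^{\alpha}y(t)=F[t,y(t)],$$ with $\alpha\in(0,1)$, where $F[t,y(t)]$ is a sufficiently regular functional of $t>0$ and $y(t)$. Then we can recast the latter in the following form: $${}^{C}\mathbf{D}_{0+}^{\alpha}y(t)=\frac{1-\alpha}{B(\alpha)}\,{}^{C}\mathbf{D}_{0+}^{\alpha}F[t,y(t)]+\frac{\alpha}{B(\alpha)}\,F[t,y(t)]+\frac{(1-\alpha)\,t^{-\alpha}}{B(\alpha)\,\Gamma(1-\alpha)}\,F[0^+,y(0^+)],$$ which is a fractional differential equation of order $\alpha\in(0,1)$ over $\mathbb{R}^+$ that involves only Caputo fractional derivatives.
   Context: The one-parameter Mittag-Leffler function is $E_\alpha(z)=\sum_{k=0}^\infty\frac{z^k}{\Gamma(\alpha k+1)}$. The Atangana-Baleanu operator in the Caputo sense (ABC operator) of order $\alpha$, $0<\alpha<1$, with base point $0$ is $${}^{ABC}\mathbf{D}_{0+}^{\alpha}f(t)=\frac{B(\alpha)}{1-\alpha}\int_0^t E_\alpha\left[-\frac{\alpha}{1-\alpha}(t-\tau)^\alpha\right]f'(\tau)\,d\tau,$$ where $f\in H^1(0,b)$, $b>0$, $f'$ is the first derivative of $f$, and $B(\alpha)$ is a normalization constant such that $B(0)=B(1)=1$. The Caputo fractional derivative of order $\alpha\in(0,1)$ is ${}^{C}\mathbf{D}_{0+}^{\alpha}f(t)=J_{0+}^{1-\alpha}f'(t)$, where $J_{0+}^{\sigma}g(t)=\frac{1}{\Gamma(\sigma)}\int_0^t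 g(\tau)(t-\tau)^{\sigma-1}\,d\tau$, $\sigma\in\mathbb{R}^+$, is the Riemann-Liouville fractional integral. ${}^{C}\mathbf{D}_{0+}^{\alpha}F[t,y(t)]$ denotes the Caputo derivative of the function $t\mapsto F[t,y(t)]$, and $F[0^+,y(0^+)]$ denotes the value of that function at $0^+$. *)

theory Defs
  imports "HOL-Analysis.Analysis"
begin

definition mittag_leffler :: "real \<Rightarrow> real \<Rightarrow> real" where
  "mittag_leffler \<alpha> z = (\<Sum>k. z ^ k / Gamma (\<alpha> * real k + 1))"

text \<open>Sobolev space on an open subset of the line, with test functions of class $C^1_c$;
  on an interval this is a standard definition and gives the same space and the same weak
  derivative as $C^\infty_c$.\<close>

definition test_functions :: "real set \<Rightarrow> (real \<Rightarrow> real) set" where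
  "test_functions S = {\<phi>. \<phi> C1_differentiable_on UNIV \<and>
     (\<exists>K. compact K \<and> K \<subseteq> S \<and> (\<forall>x. x \<notin> K \<longrightarrow> \<phi> x = 0))}"

definition locally_integrable :: "real set \<Rightarrow> (real \<Rightarrow> real) \<Rightarrow> bool" where
  "locally_integrable S f \<longleftrightarrow> (\<forall>K. compact K \<and> K \<subseteq> S \<longrightarrow> set_integrable lborel K f)"

definition has_weak_deriv :: "real set \<Rightarrow> (real \<Rightarrow> real) \<Rightarrow> (real \<Rightarrow> real) \<Rightarrow> bool" where
  "has_weak_deriv S f g \<longleftrightarrow> locally_integrable S f \<and> locally_integrable S g \<and>
     (\<forall>\<phi>\<in>test_functions S. (LBINT x:S. f x * deriv \<phi> x) = - (LBINT x:S. g x * \<phi> x))"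

definition L2 :: "real set \<Rightarrow> (real \<Rightarrow> real) set" where
  "L2 S = {f. set_borel_measurable lborel S f \<and> set_integrable lborel S (\<lambda>x. (f x)\<^sup>2)}"

definition H1 :: "real set \<Rightarrow> (real \<Rightarrow> real) set" where
  "H1 S = {f \<in> L2 S. \<exists>g\<in>L2 S. has_weak_deriv S f g}"

text \<open>A weak derivative is determined only almost everywhere; the operators below integrate it
  and so do not depend on the choice.\<close>

definition weak_deriv :: "real set \<Rightarrow> (real \<Rightarrow> real) \<Rightarrow> real \<Rightarrow> real" where
  "weak_deriv S f = (SOME g. has_weak_deriv S f g)"

text \<open>For a merely integrable \<open>g\<close> and \<open>\<sigma> < 1\<close> the Riemann-Liouville integral converges for
  almost every \<open>t\<close>, not necessarily for every \<open>t\<close>.\<close>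

definition RL_integral :: "real \<Rightarrow> (real \<Rightarrow> real) \<Rightarrow> real \<Rightarrow> real" where
  "RL_integral \<sigma> g t =
     1 / Gamma \<sigma> * (LBINT \<tau>:{0<..<t}. g \<tau> * (t - \<tau>) powr (\<sigma> - 1))"

definition caputo :: "real \<Rightarrow> (real \<Rightarrow> real) \<Rightarrow> real \<Rightarrow> real" where
  "caputo \<alpha> f = RL_integral (1 - \<alpha>) (weak_deriv {0<..} f)"

definition ABC :: "(real \<Rightarrow> real) \<Rightarrow> real \<Rightarrow> (real \<Rightarrow> real) \<Rightarrow> real \<Rightarrow> real" where
  "ABC B \<alpha> f t = B \<alpha> / (1 - \<alpha>) *
     (LBINT \<tau>:{0<..<t}. mittag_leffler \<alpha> (- (\<alpha> / (1 - \<alpha>)) * (t - \<tau>) powr \<alpha>)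
        * weak_deriv {0<..} f \<tau>)"

end

theory Submission
  imports Defs
begin

text \<open>Write \<open>*\<close> for convolution on the half line, \<open>h\<close> and \<open>k\<close> for the Riemann-Liouville kernels of
  orders \<open>\<alpha>\<close> and \<open>1 - \<alpha>\<close>, \<open>K\<close> for the Mittag-Leffler kernel, \<open>c = B(\<alpha>) / (1 - \<alpha>)\<close>,
  \<open>l = \<alpha> / (1 - \<alpha>)\<close>, and \<open>u\<close>, \<open>v\<close> for the weak derivatives of \<open>y\<close> and
  \<open>f = F[t, y(t)] = f0 + 1 * v\<close>. The Beta integral gives \<open>h * k = 1\<close>, and termwise integration of
  the Mittag-Leffler series gives \<open>K + l h * K = 1\<close>. Both equations are equivalent to the integral
  equation \<open>c (1 * u) = f + l h * f\<close>: convolving the Caputo equation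
  \<open>c k * u = k * v + l f + f0 k\<close> with \<open>h\<close> gives it, and so does applying \<open>w \<mapsto> w + l h * w\<close> to the
  ABC equation \<open>c K * u = f\<close>. Both operations are injective modulo null sets, because a further
  convolution with \<open>k\<close> or \<open>K\<close> turns them into \<open>w \<mapsto> 1 * w\<close>. Finally both sides of the
  ABC equation are continuous, so there equality almost everywhere is equality everywhere.\<close>

subsection \<open>Causal convolution\<close>

text \<open>The positive and negative parts of \<open>h\<close> are densities of finite measures
  that agree on all rays \<open>{x<..}\<close>. Rays determine such measures, and densities are
  unique almost everywhere.\<close>

lemma AE_zero_if_integrals_zero:
  fixes h :: "real \<Rightarrow> real"
  assumes h: "integrable lborel h" and zero: "\<And>x. (LBINT s:{x<..}. h s) = 0"
  shows "AE x in lborel. h x = 0"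
proof -
  have hm[measurable]: "h \<in> borel_measurable borel" using h by auto
  have int: "integrable lborel (\<lambda>s. indicator {x<..} s * max 0 (g s))"
    if "integrable lborel g" for x and g :: "real \<Rightarrow> real"
    using integrable_real_mult_indicator[of "{x<..}" lborel "\<lambda>s. max 0 (g s)"] that
    by (simp add: mult.commute)
  have em: "emeasure (density lborel (\<lambda>s. ennreal (g s))) {x<..}
      = ennreal (\<integral>s. indicator {x<..} s * max 0 (g s) \<partial>lborel)"
    if "integrable lborel g" for x and g :: "real \<Rightarrow> real"
  proof -
    have [measurable]: "g \<in> borel_measurable borel" using that by auto
    have "emeasure (density lborel (\<lambda>s. ennreal (g s))) {x<..}
        = (\<integral>\<^sup>+s. ennreal (indicator {x<..} s * max 0 (g s)) \<partial>lborel)"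
      by (subst emeasure_density)
        (auto intro!: nn_integral_cong simp: indicator_def max_def ennreal_neg)
    also have "\<dots> = ennreal (\<integral>s. indicator {x<..} s * max 0 (g s) \<partial>lborel)"
      by (intro nn_integral_eq_integral int that) auto
    finally show ?thesis .
  qed
  have h': "integrable lborel (\<lambda>s. - h s)" using h by simp
  have "density lborel (\<lambda>s. ennreal (h s)) = density lborel (\<lambda>s. ennreal (- h s))"
  proof (rule measure_eqI_lessThan)
    fix x
    have "(\<integral>s. indicator {x<..} s * max 0 (h s) \<partial>lborel) - (\<integral>s. indicator {x<..} s * max 0 (- h s) \<partial>lborel)
      = (LBINT s:{x<..}. h s)"
      unfolding set_lebesgue_integral_def Bochner_Integration.integral_diff[OF int[OF h] int[OF h'], symmetric]
      by (auto intro!: Bochner_Integration.integral_cong simp: indicator_def max_def)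
    then show "emeasure (density lborel (\<lambda>s. ennreal (h s))) {x<..}
        = emeasure (density lborel (\<lambda>s. ennreal (- h s))) {x<..}"
      using zero[of x] by (simp add: em h h')
  qed (simp_all add: em h)
  then have "AE x in lborel. ennreal (h x) = ennreal (- h x)"
    by (intro sigma_finite_measure.density_unique[OF lborel.sigma_finite_measure_axioms]) auto
  \<comment> \<open>\<open>ennreal\<close> sends negative numbers to 0, so at least one of the two
    equal values is 0, hence both are.\<close>
  then show ?thesis
    by (rule eventually_mono) (smt (verit) ennreal_eq_0_iff ennreal_inj ennreal_neg)
qed

text \<open>\<open>S\<close> is a countable union of closed intervals with rational endpoints, and
  on each of them the cut-off function \<open>indicator {p..q} x * h x\<close> falls under the
  previous lemma.\<close>

lemma AE_zero_on_open_if_interval_integrals_zero: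
  fixes h :: "real \<Rightarrow> real"
  assumes S: "open S"
    and int: "\<And>s t. s < t \<Longrightarrow> {s..t} \<subseteq> S \<Longrightarrow> set_integrable lborel {s..t} h"
    and zero: "\<And>s t. s < t \<Longrightarrow> {s..t} \<subseteq> S \<Longrightarrow> (LBINT x:{s..t}. h x) = 0"
  shows "AE x in lborel. x \<in> S \<longrightarrow> h x = 0"
proof -
  have *: "AE x in lborel. x \<in> {p..q} \<longrightarrow> h x = 0" if pq: "p < q" "{p..q} \<subseteq> S" for p q
  proof -
    have "AE x in lborel. indicator {p..q} x * h x = 0"
    proof (rule AE_zero_if_integrals_zero)
      show "integrable lborel (\<lambda>x. indicator {p..q} x * h x)"
        using int[OF pq] by (simp add: set_integrable_def)
      fix x
      show "(LBINT s:{x<..}. indicator {p..q} s * h s) = 0"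
      proof (cases "x < q")
        case False
        then have "(LBINT s:{x<..}. indicator {p..q} s * h s) = (LBINT s:{x<..}. 0)"
          by (intro set_lebesgue_integral_cong) auto
        then show ?thesis by simp
      next
        case True
        \<comment> \<open>The two effective domains of integration differ at most in the point
          \<open>x\<close>.\<close>
        have "(LBINT s:{x<..}. indicator {p..q} s * h s) = (LBINT s:{max x p..q}. h s)"
          unfolding set_lebesgue_integral_def
          by (rule integral_discrete_difference[of "{x}"]) (auto simp: indicator_def)
        also have "\<dots> = 0"
          using True pq by (intro zero) auto
        finally show ?thesis .
      qed
    qed
    then show ?thesis by (rule AE_mp) (auto intro!: AE_I2)
  qed
  have "AE x in lborel. \<forall>p\<in>\<rat>. \<forall>q\<in>\<rat>. p < q \<longrightarrow> {p..q} \<subseteq> S \<longrightarrow> x \<in> {p..q} \<longrightarrow> h x = 0"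
    unfolding AE_ball_countable[OF countable_rat] using * by (intro ballI AE_impI) auto
  then show ?thesis
  proof (rule AE_mp, intro AE_I2 impI)
    fix x assume H: "\<forall>p\<in>\<rat>. \<forall>q\<in>\<rat>. p < q \<longrightarrow> {p..q} \<subseteq> S \<longrightarrow> x \<in> {p..q} \<longrightarrow> h x = 0" and "x \<in> S"
    then obtain e where e: "e > 0" "ball x e \<subseteq> S" using S by (auto simp: open_contains_ball)
    obtain p where p: "p \<in> \<rat>" "x - e < p" "p < x" using Rats_dense_in_real[of "x - e" x] e by auto
    obtain q where q: "q \<in> \<rat>" "x < q" "q < x + e" using Rats_dense_in_real[of x "x + e"] e by auto
    have "{p..q} \<subseteq> ball x e" using p q by (auto simp: dist_real_def)
    then show "h x = 0" using H p q e by force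
  qed
qed

section \<open>Convolution of locally integrable functions\<close>

text \<open>By translation invariance the inner norm integral of \<open>A\<close> does not depend on
  \<open>p n\<close>, so Fubini reduces to the integrability of \<open>H\<close>. A general
  \<open>N\<close> and shift \<open>p\<close> serve both the double integral behind a convolution
  and the triple integral behind associativity.\<close>

lemma integrable_translate_mult:
  fixes A :: "real \<Rightarrow> real" and H :: "'a \<Rightarrow> real"
  assumes A: "integrable lborel A" and H: "integrable N H"
    and p[measurable]: "p \<in> borel_measurable N" and N: "sigma_finite_measure N"
  shows "integrable (N \<Otimes>\<^sub>M lborel) (\<lambda>(n, t). A (t - p n) * H n)"
proof -
  interpret pair_sigma_finite N lborel
    using N by (simp add: pair_sigma_finite_def lborel.sigma_finite_measure_axioms)
  have [measurable]: "A \<in> borel_measurable borel" "H \<in> borel_measurable N" using A H by auto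
  have eq: "(\<integral>t. norm (A (t - r)) \<partial>lborel) = (\<integral>t. norm (A t) \<partial>lborel)" for r
    using lborel_integral_real_affine[of 1 "\<lambda>t. norm (A t)" "- r"] by simp
  have int: "integrable lborel (\<lambda>t. A (t - r))" for r
    using lborel_integrable_real_affine[OF A, of 1 "- r"] by simp
  show ?thesis
  proof (rule Fubini_integrable)
    show "integrable N (\<lambda>n. \<integral>t. norm (case (n, t) of (n, t) \<Rightarrow> A (t - p n) * H n) \<partial>lborel)"
      using H eq by (simp add: abs_mult)
  qed (auto intro!: AE_I2 int)
qed

text \<open>Where the integrand is not integrable the value is 0 by convention. Laws that need
  integrability, such as additivity and associativity, are therefore stated for almost every
  \<open>t\<close>.\<close>

definition causal_conv :: "(real \<Rightarrow> real) \<Rightarrow> (real \<Rightarrow> real) \<Rightarrow> real \<Rightarrow> real" where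
  "causal_conv a b t = (LBINT s:{0<..<t}. a (t - s) * b s)"

text \<open>Integrability reaches down to the endpoint 0, unlike
  \<open>locally_integrable {0<..}\<close>, which only sees compact subsets of the open half
  line.\<close>

definition loc_int :: "(real \<Rightarrow> real) \<Rightarrow> bool" where
  "loc_int a \<longleftrightarrow> (\<forall>T. set_integrable lborel {0<..<T} a)"

text \<open>Truncation produces integrable functions on the whole line, where translation invariance
  and Fubini apply.\<close>

definition trunc :: "real \<Rightarrow> (real \<Rightarrow> real) \<Rightarrow> real \<Rightarrow> real" where
  "trunc T a s = indicator {0<..<T} s * a s"

lemma integrable_trunc: "loc_int a \<Longrightarrow> integrable lborel (trunc T a)"
  unfolding loc_int_def set_integrable_def trunc_def[abs_def] by simp

text \<open>\<open>0 < s\<close> and \<open>0 < t - s\<close> force \<open>s < t\<close> and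
  \<open>t - s < t\<close>, so for t \<le> T the upper cut-offs are automatic.\<close>

lemma trunc_mult_eq:
  "t \<le> T \<Longrightarrow> trunc T a (t - s) * trunc T b s = indicator {0<..<t} s *\<^sub>R (a (t - s) * b s)"
  by (auto simp: trunc_def indicator_def)

lemma causal_conv_trunc:
  "t \<le> T \<Longrightarrow> causal_conv a b t = (\<integral>s. trunc T a (t - s) * trunc T b s \<partial>lborel)"
  by (simp add: trunc_mult_eq causal_conv_def set_lebesgue_integral_def)

lemma causal_conv_nonpos: "t \<le> 0 \<Longrightarrow> causal_conv a b t = 0"
  by (simp add: causal_conv_def set_lebesgue_integral_def)

lemma AE_pos_if_AE_bounded:
  assumes "\<And>T::real. AE t in lborel. 0 < t \<and> t < T \<longrightarrow> P t"
  shows "AE t in lborel. 0 < t \<longrightarrow> P t"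
proof -
  have "AE t in lborel. \<forall>n::nat. 0 < t \<and> t < real n \<longrightarrow> P t"
    unfolding AE_all_countable using assms by blast
  then show ?thesis by (rule eventually_mono) (meson reals_Archimedean2)
qed

lemma AE_integrable_causal_conv:
  assumes "loc_int a" "loc_int b"
  shows "AE t in lborel. 0 < t \<longrightarrow> set_integrable lborel {0<..<t} (\<lambda>s. a (t - s) * b s)"
proof (rule AE_pos_if_AE_bounded)
  fix T
  have "AE t in lborel. integrable lborel (\<lambda>s. trunc T a (t - s) * trunc T b s)"
    by (rule lborel_pair.AE_integrable_snd)
      (use assms in \<open>auto intro!: integrable_translate_mult integrable_trunc lborel.sigma_finite_measure_axioms\<close>)
  then show "AE t in lborel. 0 < t \<and> t < T \<longrightarrow> set_integrable lborel {0<..<t} (\<lambda>s. a (t - s) * b s)"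
    by (rule AE_mp) (auto intro!: AE_I2 simp: set_integrable_def trunc_mult_eq)
qed

lemma loc_int_causal_conv:
  assumes "loc_int a" "loc_int b"
  shows "loc_int (causal_conv a b)"
  unfolding loc_int_def set_integrable_def
proof
  fix T
  have "integrable lborel (\<lambda>t. \<integral>s. trunc T a (t - s) * trunc T b s \<partial>lborel)"
    by (rule lborel_pair.integrable_snd)
      (use assms in \<open>auto intro!: integrable_translate_mult integrable_trunc lborel.sigma_finite_measure_axioms\<close>)
  then have "integrable lborel (\<lambda>t. indicator {0<..<T} t *\<^sub>R (\<integral>s. trunc T a (t - s) * trunc T b s \<partial>lborel))"
    by (intro integrable_mult_indicator) auto
  also have "(\<lambda>t. indicator {0<..<T} t *\<^sub>R (\<integral>s. trunc T a (t - s) * trunc T b s \<partial>lborel))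
     = (\<lambda>t. indicator {0<..<T} t *\<^sub>R causal_conv a b t)"
    by (auto simp: indicator_def causal_conv_trunc[of _ T] fun_eq_iff)
  finally show "integrable lborel (\<lambda>t. indicator {0<..<T} t *\<^sub>R causal_conv a b t)" .
qed

lemma causal_conv_commute: "causal_conv a b t = causal_conv b a t"
  unfolding causal_conv_def set_lebesgue_integral_def
  by (subst lborel_integral_real_affine[of "-1" _ t])
    (auto intro!: Bochner_Integration.integral_cong simp: indicator_def)

text \<open>Both bracketings are the same double integral over \<open>s\<close> and
  \<open>q\<close>, taken in opposite orders. Fubini applies at each \<open>t\<close> where that
  integrand is integrable, which is almost every \<open>t\<close>.\<close>

lemma causal_conv_assoc:
  assumes "loc_int a" "loc_int b" "loc_int c"
  shows "AE t in lborel. 0 < t \<longrightarrow>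
    causal_conv (causal_conv a b) c t = causal_conv a (causal_conv b c) t"
proof (rule AE_pos_if_AE_bounded)
  fix T
  define A B C where "A = trunc T a" and "B = trunc T b" and "C = trunc T c"
  have int: "integrable lborel A" "integrable lborel B" "integrable lborel C"
    using assms by (auto simp: A_def B_def C_def integrable_trunc)
  have H: "integrable (lborel \<Otimes>\<^sub>M lborel) (\<lambda>(s, q). B (q - s) * C s)"
    by (intro integrable_translate_mult int lborel.sigma_finite_measure_axioms) simp
  have sf: "sigma_finite_measure (lborel \<Otimes>\<^sub>M lborel :: (real \<times> real) measure)"
    by (rule sigma_finite_pair_measure) (rule lborel.sigma_finite_measure_axioms)+
  interpret P: pair_sigma_finite "lborel \<Otimes>\<^sub>M lborel :: (real \<times> real) measure" "lborel :: real measure"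
    using sf by (simp add: pair_sigma_finite_def lborel.sigma_finite_measure_axioms)
  have "integrable ((lborel \<Otimes>\<^sub>M lborel) \<Otimes>\<^sub>M lborel)
      (\<lambda>(n, t). A (t - snd n) * (case n of (s, q) \<Rightarrow> B (q - s) * C s))"
    by (intro integrable_translate_mult int H sf) simp
  then have "AE t in lborel. integrable (lborel \<Otimes>\<^sub>M lborel)
      (\<lambda>n. A (t - snd n) * (case n of (s, q) \<Rightarrow> B (q - s) * C s))"
    by (rule P.AE_integrable_snd)
  then show "AE t in lborel. 0 < t \<and> t < T \<longrightarrow>
    causal_conv (causal_conv a b) c t = causal_conv a (causal_conv b c) t"
  proof (rule AE_mp, intro AE_I2 impI)
    fix t assume t: "0 < t \<and> t < T"
      and "integrable (lborel \<Otimes>\<^sub>M lborel)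
        (\<lambda>n. A (t - snd n) * (case n of (s, q) \<Rightarrow> B (q - s) * C s))"
    then have I: "integrable (lborel \<Otimes>\<^sub>M lborel) (\<lambda>(s, q). A (t - q) * (B (q - s) * C s))"
      by (simp add: case_prod_unfold)
    have "causal_conv (causal_conv a b) c t
        = (\<integral>s. trunc T (causal_conv a b) (t - s) * C s \<partial>lborel)"
      using t by (simp add: causal_conv_trunc C_def)
    also have "\<dots> = (\<integral>s. (\<integral>q. A (t - q) * (B (q - s) * C s) \<partial>lborel) \<partial>lborel)"
    proof (intro Bochner_Integration.integral_cong refl)
      fix s
      show "trunc T (causal_conv a b) (t - s) * C s = (\<integral>q. A (t - q) * (B (q - s) * C s) \<partial>lborel)"
      proof (cases "0 < s")
        case False then show ?thesis by (simp add: C_def trunc_def)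
      next
        case True
        \<comment> \<open>Truncation is harmless here: \<open>t - s < T\<close>, and at arguments
          \<le> 0 a causal convolution vanishes anyway.\<close>
        have "trunc T (causal_conv a b) (t - s) = causal_conv a b (t - s)"
          using True t by (auto simp: trunc_def indicator_def causal_conv_nonpos)
        also have "\<dots> = (\<integral>q. A (t - s - q) * B q \<partial>lborel)"
          using True t by (simp add: causal_conv_trunc[of _ T] A_def B_def)
        also have "\<dots> = (\<integral>q. A (t - q) * B (q - s) \<partial>lborel)"
          by (subst lborel_integral_real_affine[of 1 _ "- s"]) simp_all
        finally show ?thesis by (simp add: mult.assoc[symmetric])
      qed
    qed
    also have "\<dots> = (\<integral>q. (\<integral>s. A (t - q) * (B (q - s) * C s) \<partial>lborel) \<partial>lborel)"
      by (rule lborel_pair.Fubini_integral[OF I, symmetric])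
    also have "\<dots> = (\<integral>q. A (t - q) * trunc T (causal_conv b c) q \<partial>lborel)"
    proof (intro Bochner_Integration.integral_cong refl)
      fix q
      show "(\<integral>s. A (t - q) * (B (q - s) * C s) \<partial>lborel) = A (t - q) * trunc T (causal_conv b c) q"
      proof (cases "q < t")
        case False then show ?thesis by (simp add: A_def trunc_def)
      next
        case True
        have "trunc T (causal_conv b c) q = causal_conv b c q"
          using True t by (auto simp: trunc_def indicator_def causal_conv_nonpos)
        also have "\<dots> = (\<integral>s. B (q - s) * C s \<partial>lborel)"
          using True t by (simp add: causal_conv_trunc[of _ T] C_def B_def)
        finally show ?thesis by simp
      qed
    qed
    also have "\<dots> = causal_conv a (causal_conv b c) t"
      using t by (simp add: causal_conv_trunc[of t T a] A_def)
    finally show "causal_conv (causal_conv a b) c t = causal_conv a (causal_conv b c) t" .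
  qed
qed

lemma borel_measurable_causal_conv_integrand:
  assumes "loc_int a" "loc_int b"
  shows "(\<lambda>s. indicator {0<..<t} s * (a (t - s) * b s)) \<in> borel_measurable lborel"
proof -
  have [measurable]: "trunc t a \<in> borel_measurable borel" "trunc t b \<in> borel_measurable borel"
    using assms[THEN integrable_trunc, of t] by auto
  have "(\<lambda>s. trunc t a (t - s) * trunc t b s) \<in> borel_measurable lborel"
    by measurable
  then show ?thesis by (simp add: trunc_mult_eq)
qed

text \<open>A null set does not affect the integral, so the conclusion holds at every
  \<open>t\<close>. Local integrability supplies the measurability needed to compare the
  integrals.\<close>

lemma causal_conv_cong_AE:
  assumes "loc_int a" "loc_int b" "loc_int b'" "AE t in lborel. 0 < t \<longrightarrow> b t = b' t"
  shows "causal_conv a b t = causal_conv a b' t"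
  unfolding causal_conv_def set_lebesgue_integral_def real_scaleR_def
  by (intro integral_cong_AE borel_measurable_causal_conv_integrand assms eventually_mono[OF assms(4)])
    (auto simp: indicator_def)

lemma loc_int_add [intro]: "loc_int a \<Longrightarrow> loc_int b \<Longrightarrow> loc_int (\<lambda>t. a t + b t)"
  by (auto simp: loc_int_def)

lemma loc_int_cmult [intro]: "loc_int a \<Longrightarrow> loc_int (\<lambda>t. c * a t)" for c :: real
  by (auto simp: loc_int_def)

lemma causal_conv_add:
  assumes "loc_int a" "loc_int b" "loc_int c"
  shows "AE t in lborel. 0 < t \<longrightarrow>
    causal_conv a (\<lambda>t. b t + c t) t = causal_conv a b t + causal_conv a c t"
  using AE_integrable_causal_conv[OF assms(1,2)] AE_integrable_causal_conv[OF assms(1,3)]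
  by eventually_elim (simp add: causal_conv_def distrib_left)

lemma causal_conv_cmult: "causal_conv a (\<lambda>t. c * b t) t = c * causal_conv a b t"
  by (simp add: causal_conv_def mult.left_commute[of _ c])

text \<open>Dominated convergence along a sequence: a convergent sequence stays in some
  \<open>{-T..T}\<close>, and a bound \<open>M\<close> for \<open>K\<close> on \<open>{0..T}\<close>
  gives the majorant \<open>M * \<bar>trunc T u s\<bar>\<close>.\<close>

lemma continuous_on_causal_conv:
  assumes K: "continuous_on {0..} K" and u: "loc_int u"
  shows "continuous_on UNIV (causal_conv K u)"
  unfolding continuous_on_sequentially
proof safe
  fix x :: "nat \<Rightarrow> real" and t assume x: "x \<longlonglongrightarrow> t"
  then obtain T where T: "\<And>n. \<bar>x n\<bar> \<le> T"
    using convergent_imp_Bseq[of x] by (auto simp: convergent_def Bseq_def)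
  then have tT: "\<bar>t\<bar> \<le> T"
    by (intro LIMSEQ_le_const2[OF tendsto_rabs[OF x]]) auto
  have "compact (K ` {0..T})"
    by (intro compact_continuous_image continuous_on_subset[OF K]) auto
  then obtain M where M: "\<And>s. 0 \<le> s \<Longrightarrow> s \<le> T \<Longrightarrow> \<bar>K s\<bar> \<le> M"
    by (force dest!: compact_imp_bounded simp: bounded_iff)
  have um[measurable]: "trunc T u \<in> borel_measurable borel"
    using integrable_trunc[OF u] by auto
  \<comment> \<open>Extending \<open>K\<close> to the left by the constant \<open>K 0\<close> gives
    a function continuous on the whole line. Only its values at nonnegative arguments enter the
    integral.\<close>
  define Kc where "Kc s = K (max 0 s)" for s
  have Kcm[measurable]: "Kc \<in> borel_measurable borel"
    unfolding Kc_def
    by (intro borel_measurable_continuous_onI continuous_on_compose2[OF K] continuous_intros) auto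
  have eq: "causal_conv K u r = (\<integral>s. indicator {0<..<r} s * (Kc (r - s) * trunc T u s) \<partial>lborel)"
    if "\<bar>r\<bar> \<le> T" for r
    unfolding causal_conv_def set_lebesgue_integral_def
    by (intro Bochner_Integration.integral_cong refl)
      (use that in \<open>auto simp: trunc_def indicator_def Kc_def max_def\<close>)
  have "(\<lambda>n. \<integral>s. indicator {0<..<x n} s * (Kc (x n - s) * trunc T u s) \<partial>lborel)
      \<longlonglongrightarrow> (\<integral>s. indicator {0<..<t} s * (Kc (t - s) * trunc T u s) \<partial>lborel)"
  proof (rule integral_dominated_convergence[where w = "\<lambda>s. M * \<bar>trunc T u s\<bar>"])
    show "integrable lborel (\<lambda>s. M * \<bar>trunc T u s\<bar>)"
      using integrable_trunc[OF u] by simp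
    show "AE s in lborel. norm (indicator {0<..<x n} s * (Kc (x n - s) * trunc T u s))
        \<le> M * \<bar>trunc T u s\<bar>" for n
    proof (intro AE_I2)
      fix s
      have "\<bar>Kc (x n - s)\<bar> \<le> M" if "0 < s" "s < x n"
        using that T[of n] by (auto simp: Kc_def intro!: M)
      moreover have "M \<ge> 0" using M[of 0] tT by fastforce
      ultimately show "norm (indicator {0<..<x n} s * (Kc (x n - s) * trunc T u s))
        \<le> M * \<bar>trunc T u s\<bar>"
        by (auto simp: indicator_def abs_mult intro!: mult_right_mono)
    qed
    \<comment> \<open>At \<open>s = t\<close> the indicators may fail to converge, but a single
      point is a null set.\<close>
    show "AE s in lborel. (\<lambda>n. indicator {0<..<x n} s * (Kc (x n - s) * trunc T u s))
        \<longlonglongrightarrow> indicator {0<..<t} s * (Kc (t - s) * trunc T u s)"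
      using AE_lborel_singleton[of t]
    proof eventually_elim
      fix s assume s: "s \<noteq> t"
      have Kcc: "continuous_on UNIV Kc"
        unfolding Kc_def by (intro continuous_on_compose2[OF K] continuous_intros) auto
      have 1: "(\<lambda>n. Kc (x n - s)) \<longlonglongrightarrow> Kc (t - s)"
        by (rule continuous_on_tendsto_compose[OF Kcc]) (auto intro!: tendsto_intros x)
      have 2: "(\<lambda>n. indicator {0<..<x n} s :: real) \<longlonglongrightarrow> indicator {0<..<t} s"
      proof (cases "s < t")
        case True
        then have "\<forall>\<^sub>F n in sequentially. s < x n" using x order_tendstoD by blast
        then show ?thesis
          by (rule tendsto_eventually[OF eventually_mono]) (use True in \<open>auto simp: indicator_def\<close>)
      next
        case False
        then have "\<forall>\<^sub>F n in sequentially. x n < s" using x s order_tendstoD by (metis linorder_neqE)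
        then show ?thesis
          by (rule tendsto_eventually[OF eventually_mono]) (use False in \<open>auto simp: indicator_def\<close>)
      qed
      show "(\<lambda>n. indicator {0<..<x n} s * (Kc (x n - s) * trunc T u s))
        \<longlonglongrightarrow> indicator {0<..<t} s * (Kc (t - s) * trunc T u s)"
        by (intro tendsto_intros 1 2)
    qed
  qed simp_all
  then show "(causal_conv K u \<circ> x) \<longlonglongrightarrow> causal_conv K u t"
    by (simp add: o_def eq T tT)
qed

lemma loc_int_continuous:
  assumes "continuous_on {0..} K"
  shows "loc_int K"
  unfolding loc_int_def
proof
  fix T
  have "set_integrable lborel {0..T} K"
    by (rule borel_integrable_atLeastAtMost') (rule continuous_on_subset[OF assms], auto)
  then show "set_integrable lborel {0<..<T} K"
    by (rule set_integrable_subset) auto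
qed

text \<open>The set of disagreement is open, so if it were nonempty it would contain an interval of
  positive length and could not be null.\<close>

lemma continuous_AE_eq_imp_eq:
  fixes f g :: "real \<Rightarrow> real"
  assumes "continuous_on {0<..} f" "continuous_on {0<..} g"
    and ae: "AE t in lborel. 0 < t \<longrightarrow> f t = g t" and "0 < t"
  shows "f t = g t"
proof (rule ccontr)
  assume ne: "f t \<noteq> g t"
  define S where "S = {0<..} \<inter> (\<lambda>t. f t - g t) -` (- {0})"
  have S: "open S" "t \<in> S"
    unfolding S_def using assms ne by (auto intro!: continuous_open_preimage continuous_on_diff)
  then obtain e where e: "e > 0" "cball t e \<subseteq> S"
    by (auto simp: open_contains_cball)
  have "AE s in lborel. s \<notin> {t-e..t+e}"
    using ae by (rule eventually_mono) (use e in \<open>auto simp: S_def cball_eq_atLeastAtMost\<close>)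
  then have "emeasure lborel {t-e..t+e} = 0"
    by (subst (asm) AE_iff_measurable[of "{t-e..t+e}"]) auto
  then show False using e by simp
qed

lemma integral_eq_causal_conv_one_diff:
  assumes u: "loc_int u" and st: "0 < s" "s < t"
  shows "(LBINT x:{s..t}. u x) = causal_conv (\<lambda>_. 1) u t - causal_conv (\<lambda>_. 1) u s"
    and "set_integrable lborel {s..t} u"
proof -
  have int: "set_integrable lborel {0<..<t+1} u" using u by (auto simp: loc_int_def)
  show *: "set_integrable lborel {s..t} u"
    by (rule set_integrable_subset[OF int]) (use st in auto)
  have 1: "set_integrable lborel {0<..<s} u" "set_integrable lborel {0<..<t} u"
    using u by (auto simp: loc_int_def)
  have "(LBINT x:{0<..<t}. u x) = (LBINT x:{0<..<s} \<union> {s..t}. u x)"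
    unfolding set_lebesgue_integral_def
    by (rule integral_discrete_difference[of "{t}"]) (use st in \<open>auto simp: indicator_def\<close>)
  also have "\<dots> = (LBINT x:{0<..<s}. u x) + (LBINT x:{s..t}. u x)"
    by (intro set_integral_Un 1 *) auto
  finally show "(LBINT x:{s..t}. u x) = causal_conv (\<lambda>_. 1) u t - causal_conv (\<lambda>_. 1) u s"
    by (simp add: causal_conv_def)
qed

text \<open>Convolution with 1 is the primitive of \<open>u\<close>. It is continuous, so vanishing
  almost everywhere means vanishing at every positive \<open>t\<close>, and then all interval
  integrals of \<open>u\<close> are 0.\<close>

lemma causal_conv_one_eq_zero_imp:
  assumes u: "loc_int u" and ae: "AE t in lborel. 0 < t \<longrightarrow> causal_conv (\<lambda>_. 1) u t = 0"
  shows "AE t in lborel. 0 < t \<longrightarrow> u t = 0"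
proof -
  have zero: "causal_conv (\<lambda>_. 1) u t = 0" if "t > 0" for t
    by (rule continuous_AE_eq_imp_eq[OF _ _ ae that])
      (rule continuous_on_subset[OF continuous_on_causal_conv[OF _ u]], auto)
  have "AE x in lborel. x \<in> {0<..} \<longrightarrow> u x = 0"
  proof (rule AE_zero_on_open_if_interval_integrals_zero)
    fix s t :: real assume st: "s < t" "{s..t} \<subseteq> {0<..}"
    then have "0 < s" by (meson atLeastAtMost_iff greaterThan_iff less_imp_le order_refl subsetD)
    then show "set_integrable lborel {s..t} u" "(LBINT x:{s..t}. u x) = 0"
      using st zero[of s] zero[of t] by (auto simp: integral_eq_causal_conv_one_diff u)
  qed simp
  then show ?thesis by simp
qed

lemma causal_conv_cong_AE_left:
  assumes "loc_int a" "loc_int a'" "loc_int b" "AE t in lborel. 0 < t \<longrightarrow> a t = a' t"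
  shows "causal_conv a b t = causal_conv a' b t"
  using causal_conv_cong_AE[OF assms(3,1,2,4)] by (simp add: causal_conv_commute[of _ b])

lemma causal_conv_linear:
  assumes "loc_int a" "loc_int b" "loc_int c"
  shows "AE t in lborel. 0 < t \<longrightarrow>
    causal_conv a (\<lambda>t. x * b t + z * c t) t = x * causal_conv a b t + z * causal_conv a c t"
  using causal_conv_add[OF assms(1) loc_int_cmult[OF assms(2)] loc_int_cmult[OF assms(3)], of x z]
  by (simp add: causal_conv_cmult)

lemma loc_int_linear:
  "loc_int a \<Longrightarrow> loc_int b \<Longrightarrow> loc_int (\<lambda>t. x * a t + z * b t)"
  by (intro loc_int_add loc_int_cmult)

lemma loc_int_const: "loc_int (\<lambda>_. c)"
  by (rule loc_int_continuous) (rule continuous_on_const)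

lemma causal_conv_one_cancel:
  assumes w: "loc_int w1" "loc_int w2"
    and eq: "AE t in lborel. 0 < t \<longrightarrow> causal_conv (\<lambda>_. 1) w1 t = causal_conv (\<lambda>_. 1) w2 t"
  shows "AE t in lborel. 0 < t \<longrightarrow> w1 t = w2 t"
proof -
  have "AE t in lborel. 0 < t \<longrightarrow> causal_conv (\<lambda>_. 1) (\<lambda>t. 1 * w1 t + - 1 * w2 t) t = 0"
    using causal_conv_linear[OF loc_int_const w, of 1 1 "-1"] eq by eventually_elim auto
  then have "AE t in lborel. 0 < t \<longrightarrow> 1 * w1 t + - 1 * w2 t = 0"
    by (rule causal_conv_one_eq_zero_imp[OF loc_int_linear[OF w]])
  then show ?thesis by simp
qed

lemma causal_conv_inverse:
  assumes "loc_int a" "loc_int b" "loc_int w" and ab: "\<forall>t>0. causal_conv a b t = 1"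
  shows "AE t in lborel. 0 < t \<longrightarrow> causal_conv a (causal_conv b w) t = causal_conv (\<lambda>_. 1) w t"
proof -
  have eq: "causal_conv (causal_conv a b) w t = causal_conv (\<lambda>_. 1) w t" for t
    by (rule causal_conv_cong_AE_left[OF loc_int_causal_conv[OF assms(1,2)] loc_int_const assms(3)])
      (simp add: ab)
  show ?thesis
    using causal_conv_assoc[OF assms(1-3)] by eventually_elim (simp add: eq)
qed

text \<open>Convolving both sides with \<open>a\<close> leaves the primitives of \<open>w1\<close>
  and \<open>w2\<close>, and a primitive determines its integrand up to a null set.\<close>

lemma causal_conv_cancel:
  assumes "loc_int a" "loc_int b" and w: "loc_int w1" "loc_int w2"
    and ab: "\<forall>t>0. causal_conv a b t = 1"
    and eq: "AE t in lborel. 0 < t \<longrightarrow> causal_conv b w1 t = causal_conv b w2 t"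
  shows "AE t in lborel. 0 < t \<longrightarrow> w1 t = w2 t"
proof (rule causal_conv_one_cancel[OF w])
  have eq: "causal_conv a (causal_conv b w1) t = causal_conv a (causal_conv b w2) t" for t
    by (intro causal_conv_cong_AE loc_int_causal_conv assms)
  show "AE t in lborel. 0 < t \<longrightarrow> causal_conv (\<lambda>_. 1) w1 t = causal_conv (\<lambda>_. 1) w2 t"
    using causal_conv_inverse[OF assms(1,2) w(1) ab] causal_conv_inverse[OF assms(1,2) w(2) ab]
    by eventually_elim (auto simp: eq)
qed

section \<open>Volterra equations and their resolvent\<close>

text \<open>Formally, in Laplace transforms, the condition reads \<open>K (1 + l h) = 1 / s\<close>:
  convolution with \<open>K\<close> is integration composed with the inverse of the map that sends
  \<open>w\<close> to \<open>w + l h * w\<close>.\<close>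

locale resolvent_pair =
  fixes h K :: "real \<Rightarrow> real" and l :: real
  assumes h: "loc_int h" and K: "loc_int K"
    and resolvent: "\<And>t. 0 < t \<Longrightarrow> K t + l * causal_conv h K t = 1"
begin

text \<open>This is the equation for \<open>K\<close> convolved with \<open>w\<close>; associativity
  moves \<open>w\<close> inside.\<close>

lemma resolvent_left:
  assumes w: "loc_int w"
  shows "AE t in lborel. 0 < t \<longrightarrow>
    causal_conv K w t + l * causal_conv h (causal_conv K w) t = causal_conv (\<lambda>_. 1) w t"
proof -
  have hK: "loc_int (causal_conv h K)" by (intro loc_int_causal_conv h K)
  have eq: "causal_conv (\<lambda>t. 1 * K t + l * causal_conv h K t) w t = causal_conv (\<lambda>_. 1) w t" for t
    by (rule causal_conv_cong_AE_left[OF loc_int_linear[OF K hK] loc_int_const w]) (simp add: resolvent)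
  show ?thesis
    using causal_conv_linear[OF w K hK, of 1 l] causal_conv_assoc[OF h K w]
    by eventually_elim (simp add: eq[simplified] causal_conv_commute[of w])
qed

text \<open>The perturbation now acts before \<open>K\<close> instead of after it; commutativity of
  \<open>K\<close> and \<open>h\<close> reduces this to \<open>resolvent_left\<close>.\<close>

lemma resolvent_right:
  assumes w: "loc_int w"
  shows "AE t in lborel. 0 < t \<longrightarrow>
    causal_conv K (\<lambda>t. w t + l * causal_conv h w t) t = causal_conv (\<lambda>_. 1) w t"
proof -
  have comm: "causal_conv K h = causal_conv h K" by (rule ext) (rule causal_conv_commute)
  show ?thesis
    using resolvent_left[OF w] causal_conv_linear[OF K w loc_int_causal_conv[OF h w], of 1 l]
      causal_conv_assoc[OF K h w] causal_conv_assoc[OF h K w]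
    by eventually_elim (simp add: comm)
qed

text \<open>The forward direction is congruence. For the converse, convolution with \<open>K\<close>
  leaves equal primitives by \<open>resolvent_right\<close>.\<close>

lemma perturbation_cancel:
  assumes w: "loc_int w1" "loc_int w2"
  shows "(AE t in lborel. 0 < t \<longrightarrow> w1 t = w2 t) \<longleftrightarrow>
    (AE t in lborel. 0 < t \<longrightarrow> w1 t + l * causal_conv h w1 t = w2 t + l * causal_conv h w2 t)"
    (is "?L \<longleftrightarrow> ?R")
proof
  assume L: ?L
  have "causal_conv h w1 t = causal_conv h w2 t" for t
    by (intro causal_conv_cong_AE h w L)
  with L show ?R by simp
next
  assume R: ?R
  have P: "loc_int (\<lambda>t. w t + l * causal_conv h w t)" if "loc_int w" for w
    using that by (intro loc_int_add loc_int_cmult loc_int_causal_conv h)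
  have eq: "causal_conv K (\<lambda>t. w1 t + l * causal_conv h w1 t) t
      = causal_conv K (\<lambda>t. w2 t + l * causal_conv h w2 t) t" for t
    by (intro causal_conv_cong_AE K P w R)
  have "AE t in lborel. 0 < t \<longrightarrow> causal_conv (\<lambda>_. 1) w1 t = causal_conv (\<lambda>_. 1) w2 t"
    using resolvent_right[OF w(1)] resolvent_right[OF w(2)] by eventually_elim (auto simp: eq)
  then show ?L by (rule causal_conv_one_cancel[OF w])
qed

end

subsection \<open>Riemann-Liouville and Mittag-Leffler kernels\<close>

definition rl_kernel :: "real \<Rightarrow> real \<Rightarrow> real" where
  "rl_kernel \<beta> t = t powr (\<beta> - 1) / Gamma \<beta>"

lemma rl_kernel_pos: "0 < \<beta> \<Longrightarrow> 0 < t \<Longrightarrow> 0 < rl_kernel \<beta> t"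
  by (simp add: rl_kernel_def)

lemma integral_Beta:
  assumes "a > 0" "b > (0::real)"
  shows "(LBINT x:{0<..<1}. x powr (a - 1) * (1 - x) powr (b - 1)) = Beta a b"
proof -
  have "(LBINT x:{0<..<1}. x powr (a - 1) * (1 - x) powr (b - 1))
      = (LBINT x:{0..1}. x powr (a - 1) * (1 - x) powr (b - 1))"
    by (rule set_integral_discrete_difference[of "{0, 1}"]) auto
  also have "\<dots> = integral {0..1} (\<lambda>x. x powr (a - 1) * (1 - x) powr (b - 1))"
    by (rule set_borel_integral_eq_integral(2)) (rule integrable_Beta[OF assms])
  also have "\<dots> = Beta a b"
    using has_integral_Beta_real[OF assms] by (rule integral_unique)
  finally show ?thesis .
qed

text \<open>The substitution \<open>s = t * x\<close> leads to the Beta integral, whose Gamma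
  factors cancel the normalisations of the two kernels.\<close>

lemma causal_conv_rl_kernel:
  assumes "0 < a" "0 < b" "0 < t"
  shows "causal_conv (rl_kernel a) (rl_kernel b) t = rl_kernel (a + b) t"
proof -
  have "causal_conv (rl_kernel a) (rl_kernel b) t
      = t * (\<integral>x. indicator {0<..<t} (t * x) * (rl_kernel a (t - t * x) * rl_kernel b (t * x)) \<partial>lborel)"
    unfolding causal_conv_def set_lebesgue_integral_def
    by (subst lborel_integral_real_affine[of t _ 0]) (use assms in simp_all)
  also have "(\<integral>x. indicator {0<..<t} (t * x) * (rl_kernel a (t - t * x) * rl_kernel b (t * x)) \<partial>lborel)
    = (\<integral>x. t powr (a + b - 2) / (Gamma a * Gamma b) *
        (indicator {0<..<1} x *\<^sub>R (x powr (b - 1) * (1 - x) powr (a - 1))) \<partial>lborel)"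
  proof (intro Bochner_Integration.integral_cong refl)
    fix x
    show "indicator {0<..<t} (t * x) * (rl_kernel a (t - t * x) * rl_kernel b (t * x))
      = t powr (a + b - 2) / (Gamma a * Gamma b) *
        (indicator {0<..<1} x *\<^sub>R (x powr (b - 1) * (1 - x) powr (a - 1)))"
    proof (cases "0 < x \<and> x < 1")
      case True
      have "t - t * x = t * (1 - x)" by (simp add: algebra_simps)
      then have "(t - t * x) powr (a - 1) * (t * x) powr (b - 1)
        = (t powr (a - 1) * t powr (b - 1)) * ((1 - x) powr (a - 1) * x powr (b - 1))"
        using True assms by (simp add: powr_mult)
      also have "t powr (a - 1) * t powr (b - 1) = t powr (a + b - 2)"
        by (simp add: powr_add[symmetric] algebra_simps)
      finally show ?thesis using True assms by (simp add: rl_kernel_def)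
    next
      case False
      then have "\<not> (0 < t * x \<and> t * x < t)" using assms by (auto simp: zero_less_mult_iff)
      with False show ?thesis by (auto simp: indicator_def)
    qed
  qed
  also have "\<dots> = t powr (a + b - 2) / (Gamma a * Gamma b) * Beta b a"
    by (simp add: integral_Beta[of b a, OF assms(2,1), symmetric] set_lebesgue_integral_def)
  also have "t * (t powr (a + b - 2) / (Gamma a * Gamma b) * Beta b a) = (t powr 1 * t powr (a + b - 2)) / Gamma (a + b)"
    using assms Gamma_real_pos[of a] Gamma_real_pos[of b]
    by (simp add: Beta_def add.commute less_imp_neq[symmetric])
  also have "\<dots> = rl_kernel (a + b) t"
    unfolding powr_add[symmetric] by (simp add: rl_kernel_def algebra_simps)
  finally show ?thesis .
qed

lemma set_integrable_rl_kernel_conv: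
  assumes "0 < a" "0 < b" "0 < t"
  shows "set_integrable lborel {0<..<t} (\<lambda>s. rl_kernel a (t - s) * rl_kernel b s)"
proof (rule ccontr)
  \<comment> \<open>a non-integrable function would have the integral 0, but the value is positive\<close>
  assume "\<not> ?thesis"
  then have "causal_conv (rl_kernel a) (rl_kernel b) t = 0"
    unfolding causal_conv_def set_lebesgue_integral_def set_integrable_def
    by (rule not_integrable_integral_eq)
  then show False
    using causal_conv_rl_kernel[OF assms] rl_kernel_pos[of "a + b" t] assms by simp
qed

lemma loc_int_rl_kernel:
  assumes "0 < \<beta>"
  shows "loc_int (rl_kernel \<beta>)"
  unfolding loc_int_def
proof
  fix T :: real
  show "set_integrable lborel {0<..<T} (rl_kernel \<beta>)"
  proof (cases "T > 0")
    case True
    \<comment> \<open>\<open>rl_kernel 1\<close> equals 1 at positive arguments, so this convolution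
      integrand is \<open>rl_kernel \<beta>\<close> itself.\<close>
    have "set_integrable lborel {0<..<T} (\<lambda>s. rl_kernel 1 (T - s) * rl_kernel \<beta> s)"
      using assms True by (intro set_integrable_rl_kernel_conv) auto
    then show ?thesis
      by (subst set_integrable_cong[OF refl refl]) (auto simp: rl_kernel_def)
  qed simp
qed

section \<open>The Mittag-Leffler series and its resolvent equation\<close>

text \<open>Restrict the Gamma integral to \<open>{M..M+1}\<close> and bound both factors of the
  integrand there. As \<open>M\<close> is free, Gamma outgrows every geometric sequence.\<close>

lemma Gamma_ge:
  fixes M x :: real
  assumes M: "M > 0" and x: "x \<ge> 0"
  shows "Gamma (x + 1) \<ge> M powr x * exp (- (M + 1))"
proof -
  have G: "((\<lambda>t. t powr (x + 1 - 1) / exp t) has_integral Gamma (x + 1)) {0..}"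
    by (rule Gamma_integral_real) (use x in simp)
  have "((\<lambda>t. M powr x * exp (- (M + 1))) has_integral M powr x * exp (- (M + 1))) {M..M+1}"
    using has_integral_const_real[of "M powr x * exp (- (M + 1))" M "M + 1"] by simp
  then have C: "((\<lambda>t. if t \<in> {M..M+1} then M powr x * exp (- (M + 1)) else 0) has_integral
      M powr x * exp (- (M + 1))) {0..}"
    by (subst has_integral_restrict) (use M in auto)
  have "(if t \<in> {M..M+1} then M powr x * exp (- (M + 1)) else 0) \<le> t powr (x + 1 - 1) / exp t"
    for t :: real
    using M x by (auto simp: divide_inverse exp_minus[symmetric] intro!: mult_mono powr_mono2)
  then show ?thesis
    by (intro has_integral_le[OF C G])
qed

lemma summable_mittag_leffler:
  assumes \<alpha>: "\<alpha> > 0"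
  shows "summable (\<lambda>k. z ^ k / Gamma (\<alpha> * real k + 1))"
proof -
  \<comment> \<open>This makes \<open>M powr \<alpha>\<close> equal to
    \<open>2 * \<bar>z\<bar> + 1\<close>, so the terms decay at least like powers of 1/2; the
    summand 1 keeps \<open>M\<close> positive at \<open>z = 0\<close>.\<close>
  define M where "M = (2 * \<bar>z\<bar> + 1) powr (1 / \<alpha>)"
  have M: "M > 0" by (simp add: M_def)
  have M\<alpha>: "M powr \<alpha> = 2 * \<bar>z\<bar> + 1" using \<alpha> by (simp add: M_def powr_powr)
  show ?thesis
  proof (rule summable_comparison_test')
    show "summable (\<lambda>k. exp (M + 1) * (1 / 2 :: real) ^ k)"
      by (intro summable_mult summable_geometric) simp
    fix k :: nat
    have "(2 * \<bar>z\<bar> + 1) ^ k * exp (- (M + 1)) \<le> Gamma (\<alpha> * real k + 1)"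
      using Gamma_ge[OF M, of "\<alpha> * real k"] \<alpha>
      by (simp add: powr_powr[symmetric] M\<alpha> powr_realpow)
    moreover have "\<bar>z\<bar> ^ k \<le> (1 / 2) ^ k * (2 * \<bar>z\<bar> + 1) ^ k"
      unfolding power_mult_distrib[symmetric] by (intro power_mono) auto
    ultimately have "\<bar>z\<bar> ^ k * exp (- (M + 1)) \<le> (1 / 2) ^ k * Gamma (\<alpha> * real k + 1)"
      by (smt (verit, best) exp_gt_zero mult.assoc mult_left_mono mult_right_mono zero_le_power divide_nonneg_nonneg)
    moreover have "Gamma (\<alpha> * real k + 1) > 0"
      using \<alpha> by (intro Gamma_real_pos) (simp add: add_nonneg_pos)
    ultimately have "\<bar>z\<bar> ^ k / Gamma (\<alpha> * real k + 1) \<le> (1 / 2) ^ k / exp (- (M + 1))"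
      by (simp only: divide_le_eq pos_le_divide_eq exp_gt_zero times_divide_eq_left if_True)
    then show "norm (z ^ k / Gamma (\<alpha> * real k + 1)) \<le> exp (M + 1) * (1 / 2) ^ k"
      using \<open>Gamma (\<alpha> * real k + 1) > 0\<close>
      by (simp only: exp_minus norm_divide real_norm_def power_abs divide_inverse inverse_inverse_eq abs_of_pos
          abs_mult abs_inverse mult.commute)
  qed
qed

lemma isCont_mittag_leffler:
  assumes "\<alpha> > 0"
  shows "isCont (mittag_leffler \<alpha>) z"
  unfolding mittag_leffler_def[abs_def]
  using isCont_powser_converges_everywhere[of "\<lambda>k. 1 / Gamma (\<alpha> * real k + 1)" z]
    summable_mittag_leffler[OF assms] by simp

definition ml_kernel :: "real \<Rightarrow> real \<Rightarrow> real \<Rightarrow> real" where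
  "ml_kernel \<alpha> l t = mittag_leffler \<alpha> (- l * t powr \<alpha>)"

lemma continuous_on_ml_kernel:
  assumes "\<alpha> > 0"
  shows "continuous_on {0..} (ml_kernel \<alpha> l)"
  unfolding ml_kernel_def[abs_def]
  by (rule continuous_on_compose2[of UNIV "mittag_leffler \<alpha>"])
    (auto intro: assms continuous_at_imp_continuous_on isCont_mittag_leffler
      intro!: continuous_on_minus continuous_on_mult continuous_on_const continuous_on_powr' continuous_on_id)

text \<open>Each term of the series is a multiple of a Riemann-Liouville kernel, so convolution with
  \<open>rl_kernel \<alpha>\<close> can be computed termwise.\<close>

lemma ml_kernel_term:
  assumes "0 < t"
  shows "(c * t powr \<alpha>) ^ k / Gamma (\<alpha> * real k + 1) = c ^ k * rl_kernel (\<alpha> * real k + 1) t"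
  using assms by (simp add: rl_kernel_def power_mult_distrib powr_realpow[symmetric] powr_powr)

lemma ml_kernel_sums:
  assumes "\<alpha> > 0" "0 < t"
  shows "summable (\<lambda>k. c ^ k * rl_kernel (\<alpha> * real k + 1) t)"
    and "ml_kernel \<alpha> l t = (\<Sum>k. (- l) ^ k * rl_kernel (\<alpha> * real k + 1) t)"
  using summable_mittag_leffler[OF assms(1), of "c * t powr \<alpha>"]
  by (simp_all only: ml_kernel_term[OF assms(2)] ml_kernel_def mittag_leffler_def)

text \<open>Convolution with \<open>rl_kernel \<alpha>\<close> raises the order of the
  \<open>k\<close>-th term to that of the next one. After the factor \<open>l\<close> the result is
  minus the series without its first term, and that first term is 1.\<close>

lemma causal_conv_ml_kernel:
  assumes \<alpha>: "\<alpha> > 0" and t: "0 < t"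
  shows "ml_kernel \<alpha> l t + l * causal_conv (rl_kernel \<alpha>) (ml_kernel \<alpha> l) t = 1"
proof -
  define a where "a k = (- l) ^ k * rl_kernel (\<alpha> * real k + 1) t" for k
  define f where "f k s = indicator {0<..<t} s * (rl_kernel \<alpha> (t - s) * ((- l) ^ k * rl_kernel (\<alpha> * real k + 1) s))"
    for k s
  have pos: "\<alpha> * real k + 1 > 0" for k using \<alpha> by (simp add: add_nonneg_pos)
  have f_eq: "f k s = (- l) ^ k * (indicator {0<..<t} s *\<^sub>R (rl_kernel \<alpha> (t - s) * rl_kernel (\<alpha> * real k + 1) s))"
    for k s by (simp add: f_def)
  have nf_eq: "norm (f k s) = \<bar>l\<bar> ^ k * (indicator {0<..<t} s *\<^sub>R (rl_kernel \<alpha> (t - s) * rl_kernel (\<alpha> * real k + 1) s))"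
    for k s
    using rl_kernel_pos[OF \<alpha>, of "t - s"] rl_kernel_pos[OF pos[of k], of s]
    by (auto simp: f_eq indicator_def abs_mult power_abs)
  have intf: "integrable lborel (f k)" for k
    using set_integrable_rl_kernel_conv[OF \<alpha> pos[of k] t]
    unfolding f_eq[abs_def] set_integrable_def by (rule integrable_mult_right)
  have I: "(\<integral>s. c * (indicator {0<..<t} s *\<^sub>R (rl_kernel \<alpha> (t - s) * rl_kernel (\<alpha> * real k + 1) s)) \<partial>lborel)
    = c * rl_kernel (\<alpha> * real (Suc k) + 1) t" for k c
    using causal_conv_rl_kernel[OF \<alpha> pos[of k] t]
    by (simp add: causal_conv_def set_lebesgue_integral_def algebra_simps)
  have sa: "summable a" unfolding a_def by (rule ml_kernel_sums[OF \<alpha> t])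
  \<comment> \<open>These are the integrals of the norms. Up to a factor
    \<open>\<bar>l\<bar>\<close> they form the series with parameter \<open>\<bar>l\<bar>\<close>
    without its first term; the division by \<open>\<bar>l\<bar>\<close> is why \<open>l = 0\<close>
    is separate.\<close>
  have suml: "summable (\<lambda>k. \<bar>l\<bar> ^ k * rl_kernel (\<alpha> * real (Suc k) + 1) t)"
  proof (cases "l = 0")
    case True
    show ?thesis by (rule summable_finite[of "{0}"]) (auto simp: True)
  next
    case False
    have "summable (\<lambda>k. 1 / \<bar>l\<bar> * (\<bar>l\<bar> ^ Suc k * rl_kernel (\<alpha> * real (Suc k) + 1) t))"
      using ml_kernel_sums(1)[OF \<alpha> t, of "\<bar>l\<bar>"] by (intro summable_mult) (subst summable_Suc_iff)
    then show ?thesis using False by (simp add: field_simps)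
  qed
  have "causal_conv (rl_kernel \<alpha>) (ml_kernel \<alpha> l) t = (\<integral>s. (\<Sum>k. f k s) \<partial>lborel)"
    unfolding causal_conv_def set_lebesgue_integral_def
  proof (intro Bochner_Integration.integral_cong refl)
    fix s
    show "indicator {0<..<t} s *\<^sub>R (rl_kernel \<alpha> (t - s) * ml_kernel \<alpha> l s) = (\<Sum>k. f k s)"
    proof (cases "s \<in> {0<..<t}")
      case True
      then have "s > 0" by simp
      show ?thesis
        using True ml_kernel_sums[OF \<alpha> \<open>s > 0\<close>]
        by (simp add: f_def suminf_mult)
    qed (simp add: f_def)
  qed
  also have "\<dots> = (\<Sum>k. \<integral>s. f k s \<partial>lborel)"
  proof (rule integral_suminf)
    show "AE s in lborel. summable (\<lambda>k. norm (f k s))"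
    proof (intro AE_I2)
      fix s
      show "summable (\<lambda>k. norm (f k s))"
      proof (cases "s \<in> {0<..<t}")
        case True
        then have "s > 0" by simp
        have "summable (\<lambda>k. rl_kernel \<alpha> (t - s) * (\<bar>l\<bar> ^ k * rl_kernel (\<alpha> * real k + 1) s))"
          by (intro summable_mult ml_kernel_sums \<alpha> \<open>s > 0\<close>)
        then show ?thesis using True unfolding nf_eq by (simp add: mult.left_commute)
      qed (simp add: f_def)
    qed
    show "summable (\<lambda>k. \<integral>s. norm (f k s) \<partial>lborel)"
      using suml by (simp only: nf_eq I)
  qed (rule intf)
  also have "\<dots> = (\<Sum>k. (- l) ^ k * rl_kernel (\<alpha> * real (Suc k) + 1) t)"
    by (simp only: f_eq I)
  finally have "l * causal_conv (rl_kernel \<alpha>) (ml_kernel \<alpha> l) t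
      = (\<Sum>k. l * ((- l) ^ k * rl_kernel (\<alpha> * real (Suc k) + 1) t))"
    using suml by (subst suminf_mult)
      (auto intro!: summable_comparison_test'[OF suml] simp: abs_mult power_abs
        rl_kernel_pos[OF pos t, THEN less_imp_le] simp del: of_nat_Suc)
  also have "\<dots> = (\<Sum>k. - a (Suc k))"
    by (intro suminf_cong) (simp add: a_def)
  also have "\<dots> = - (suminf a - a 0)"
    using sa by (subst suminf_minus) (auto simp: suminf_split_head summable_Suc_iff)
  finally show ?thesis
    using t by (simp add: ml_kernel_sums(2)[OF \<alpha> t] a_def[abs_def, symmetric])
      (simp add: a_def rl_kernel_def)
qed

section \<open>Reduction of both equations to one integral equation\<close>

lemma ABC_caputo_equivalence:
  assumes \<alpha>: "0 < \<alpha>" "\<alpha> < 1" and u: "loc_int u" and v: "loc_int v"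
    and f: "\<And>t. 0 < t \<Longrightarrow> f t = f0 + causal_conv (\<lambda>_. 1) v t"
  shows "(AE t in lborel. 0 < t \<longrightarrow> c * causal_conv (ml_kernel \<alpha> l) u t = f t) \<longleftrightarrow>
    (AE t in lborel. 0 < t \<longrightarrow> c * causal_conv (rl_kernel (1 - \<alpha>)) u t
      = causal_conv (rl_kernel (1 - \<alpha>)) v t + l * f t + f0 * rl_kernel (1 - \<alpha>) t)"
    (is "?ABC \<longleftrightarrow> ?C")
proof -
  define h k K where "h = rl_kernel \<alpha>" and "k = rl_kernel (1 - \<alpha>)" and "K = ml_kernel \<alpha> l"
  have h: "loc_int h" and k: "loc_int k" and K: "loc_int K"
    unfolding h_def k_def K_def using \<alpha>
    by (simp_all add: loc_int_rl_kernel loc_int_continuous continuous_on_ml_kernel)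
  have hk: "\<forall>t>0. causal_conv h k t = 1"
    using causal_conv_rl_kernel[of \<alpha> "1 - \<alpha>"] \<alpha> by (simp add: h_def k_def rl_kernel_def)
  then have kh: "\<forall>t>0. causal_conv k h t = 1"
    by (simp add: causal_conv_commute[of k])
  interpret resolvent_pair h K l
    by unfold_locales (use causal_conv_ml_kernel[OF \<alpha>(1)] h K in \<open>simp_all add: h_def K_def\<close>)
  \<comment> \<open>\<open>g\<close> is the formula that \<open>f\<close> satisfies for
    \<open>t > 0\<close>; local integrability can be read off from it.\<close>
  define g where "g t = f0 + causal_conv (\<lambda>_. 1) v t" for t
  have fg: "f t = g t" if "0 < t" for t using f[OF that] by (simp add: g_def)
  have gi: "loc_int g"
    unfolding g_def[abs_def] by (intro loc_int_add loc_int_const loc_int_causal_conv v)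
  have Ku: "loc_int (causal_conv K u)" and ku: "loc_int (causal_conv k u)" and kv: "loc_int (causal_conv k v)"
    by (intro loc_int_causal_conv K k u v)+
  \<comment> \<open>The integral equation in which the two chains of equivalences meet.\<close>
  let ?mid = "AE t in lborel. 0 < t \<longrightarrow> c * causal_conv (\<lambda>_. 1) u t = g t + l * causal_conv h g t"
  have "?ABC \<longleftrightarrow> (AE t in lborel. 0 < t \<longrightarrow> c * causal_conv K u t = g t)"
    by (intro AE_cong) (auto simp: K_def fg)
  also have "\<dots> \<longleftrightarrow> (AE t in lborel. 0 < t \<longrightarrow>
      c * causal_conv K u t + l * causal_conv h (\<lambda>t. c * causal_conv K u t) t = g t + l * causal_conv h g t)"
    by (rule perturbation_cancel) (intro loc_int_cmult Ku gi)+
  also have "\<dots> \<longleftrightarrow> ?mid"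
  proof -
    have "AE t in lborel. 0 < t \<longrightarrow> c * causal_conv K u t + l * causal_conv h (\<lambda>t. c * causal_conv K u t) t
        = c * causal_conv (\<lambda>_. 1) u t"
      using resolvent_left[OF u]
    proof eventually_elim
      case (elim t)
      then have "0 < t \<longrightarrow> c * (causal_conv K u t + l * causal_conv h (causal_conv K u) t)
        = c * causal_conv (\<lambda>_. 1) u t" by simp
      then show ?case by (simp only: causal_conv_cmult distrib_left mult.left_commute)
    qed
    then have "AE t in lborel. (0 < t \<longrightarrow> c * causal_conv K u t + l * causal_conv h (\<lambda>t. c * causal_conv K u t) t
        = g t + l * causal_conv h g t) = (0 < t \<longrightarrow> c * causal_conv (\<lambda>_. 1) u t = g t + l * causal_conv h g t)"
      by eventually_elim auto
    then show ?thesis by (rule eventually_subst)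
  qed
  finally have 1: "?ABC \<longleftrightarrow> ?mid" .
  \<comment> \<open>The right-hand side of the Caputo equation; the factors 1 give it the shape for
    applying \<open>causal_conv_linear\<close> twice.\<close>
  define r where "r t = 1 * (1 * causal_conv k v t + l * g t) + f0 * k t" for t
  have r: "loc_int r" unfolding r_def[abs_def] by (intro loc_int_linear gi kv k)
  \<comment> \<open>Convolution with \<open>h\<close> sends \<open>causal_conv k v\<close> to the
    primitive of \<open>v\<close> and \<open>f0 * k t\<close> to \<open>f0\<close>; together these
    are \<open>g\<close>.\<close>
  have rg: "AE t in lborel. 0 < t \<longrightarrow> causal_conv h r t = g t + l * causal_conv h g t"
    unfolding r_def[abs_def]
    using causal_conv_linear[OF h loc_int_linear[OF kv gi, of 1 l] k, of 1 f0] causal_conv_linear[OF h kv gi, of 1 l]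
      causal_conv_inverse[OF h k v hk]
    by eventually_elim (auto simp: hk g_def)
  have cu: "AE t in lborel. 0 < t \<longrightarrow> causal_conv h (\<lambda>t. c * causal_conv k u t) t = c * causal_conv (\<lambda>_. 1) u t"
    using causal_conv_inverse[OF h k u hk] by eventually_elim (simp add: causal_conv_cmult)
  have "?C \<longleftrightarrow> (AE t in lborel. 0 < t \<longrightarrow> c * causal_conv k u t = r t)"
    by (intro AE_cong) (auto simp: k_def r_def fg)
  also have "\<dots> \<longleftrightarrow> (AE t in lborel. 0 < t \<longrightarrow> causal_conv h (\<lambda>t. c * causal_conv k u t) t = causal_conv h r t)"
  proof
    assume L: "AE t in lborel. 0 < t \<longrightarrow> c * causal_conv k u t = r t"
    have "causal_conv h (\<lambda>t. c * causal_conv k u t) t = causal_conv h r t" for t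
      by (intro causal_conv_cong_AE h r loc_int_cmult ku L)
    then show "AE t in lborel. 0 < t \<longrightarrow> causal_conv h (\<lambda>t. c * causal_conv k u t) t = causal_conv h r t"
      by simp
  next
    assume "AE t in lborel. 0 < t \<longrightarrow> causal_conv h (\<lambda>t. c * causal_conv k u t) t = causal_conv h r t"
    then show "AE t in lborel. 0 < t \<longrightarrow> c * causal_conv k u t = r t"
      by (rule causal_conv_cancel[OF k h loc_int_cmult[OF ku] r kh])
  qed
  also have "\<dots> \<longleftrightarrow> ?mid"
  proof -
    have "AE t in lborel. (0 < t \<longrightarrow> causal_conv h (\<lambda>t. c * causal_conv k u t) t = causal_conv h r t)
        = (0 < t \<longrightarrow> c * causal_conv (\<lambda>_. 1) u t = g t + l * causal_conv h g t)"
      using rg cu by eventually_elim auto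
    then show ?thesis by (rule eventually_subst)
  qed
  finally show ?thesis using 1 by simp
qed

subsection \<open>Weak derivatives on the half line\<close>

text \<open>A \<open>C\<^sup>1\<close> step from 0 to 1 on \<open>[0, 1]\<close>, obtained as a second difference of \<open>z * \<bar>z\<bar>\<close>,
  whose derivative is the continuous function \<open>2 * \<bar>z\<bar>\<close>. Differences of rescaled copies are the
  test functions that approximate the indicator of an interval.\<close>

definition c1_step :: "real \<Rightarrow> real" where
  "c1_step z = z * \<bar>z\<bar> - 2 * ((z - 1/2) * \<bar>z - 1/2\<bar>) + (z - 1) * \<bar>z - 1\<bar> + 1/2"

definition tent :: "real \<Rightarrow> real" where
  "tent z = 2 * \<bar>z\<bar> - 4 * \<bar>z - 1/2\<bar> + 2 * \<bar>z - 1\<bar>"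

text \<open>At \<open>c\<close> the difference quotient is \<open>\<bar>z - c\<bar>\<close>, which
  tends to 0; elsewhere the function is locally plus or minus a square.\<close>

lemma DERIV_mult_abs: "((\<lambda>z. (z - c) * \<bar>z - c\<bar>) has_real_derivative 2 * \<bar>x - c\<bar>) (at x)"
  for c x :: real
proof (cases "x = c")
  case True
  have "((\<lambda>z. \<bar>z - c\<bar>) \<longlongrightarrow> \<bar>c - c\<bar>) (at c)" by (intro tendsto_intros)
  moreover have "\<forall>\<^sub>F z in at c. \<bar>z - c\<bar> = ((z - c) * \<bar>z - c\<bar> - (c - c) * \<bar>c - c\<bar>) / (z - c)"
    by (auto simp: eventually_at_filter)
  ultimately show ?thesis
    by (simp add: True has_field_derivative_iff) (auto elim: Lim_transform_eventually)
next
  case False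
  have "((\<lambda>z. (z - c) * (sgn (x - c) * (z - c))) has_real_derivative 2 * \<bar>x - c\<bar>) (at x)"
    by (auto intro!: derivative_eq_intros simp: abs_sgn)
  moreover have "\<forall>\<^sub>F z in nhds x. (z - c) * (sgn (x - c) * (z - c)) = (z - c) * \<bar>z - c\<bar>"
  proof (cases "x > c")
    case True
    then show ?thesis
      by (intro eventually_mono[OF eventually_nhds_in_open[of "{c<..}"]]) auto
  next
    case False
    with \<open>x \<noteq> c\<close> show ?thesis
      by (intro eventually_mono[OF eventually_nhds_in_open[of "{..<c}"]]) auto
  qed
  ultimately show ?thesis by (subst (asm) DERIV_cong_ev) auto
qed

lemma DERIV_c1_step: "(c1_step has_real_derivative tent x) (at x)"
proof -
  have "((\<lambda>z. (z - 0) * \<bar>z - 0\<bar> - 2 * ((z - 1/2) * \<bar>z - 1/2\<bar>) + (z - 1) * \<bar>z - 1\<bar> + 1/2)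
    has_real_derivative (2 * \<bar>x - 0\<bar> - 2 * (2 * \<bar>x - 1/2\<bar>) + 2 * \<bar>x - 1\<bar> + 0)) (at x)"
    by (intro DERIV_add DERIV_diff DERIV_cmult DERIV_mult_abs DERIV_const)
  then show ?thesis by (simp add: c1_step_def[abs_def] tent_def)
qed

lemma c1_step_le_0: "z \<le> 0 \<Longrightarrow> c1_step z = 0"
  by (simp add: c1_step_def algebra_simps)

lemma c1_step_ge_1: "1 \<le> z \<Longrightarrow> c1_step z = 1"
  by (simp add: c1_step_def algebra_simps)

lemma tent_nonneg: "0 \<le> tent z"
  by (simp add: tent_def abs_if)

lemma tent_eq_0: "z \<le> 0 \<or> 1 \<le> z \<Longrightarrow> tent z = 0"
  by (auto simp: tent_def)

lemma continuous_on_tent: "continuous_on S tent"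
  unfolding tent_def[abs_def] by (intro continuous_intros)

lemma c1_step_mono: "x \<le> y \<Longrightarrow> c1_step x \<le> c1_step y"
  by (rule DERIV_nonneg_imp_nondecreasing) (use DERIV_c1_step tent_nonneg in auto)

lemma c1_step_bounds: "0 \<le> c1_step z" "c1_step z \<le> 1"
  using c1_step_mono[of "min z 0" z] c1_step_mono[of z "max z 1"]
  by (simp_all add: c1_step_le_0 c1_step_ge_1)

lemma tent_indicator: "indicator {0..1} z * tent z = tent z"
  by (cases "z \<in> {0..1}") (auto simp: tent_eq_0)

lemma integral_tent: "integrable lborel tent" "(\<integral>z. tent z \<partial>lborel) = 1"
proof -
  have "set_integrable lborel {0..1} tent"
    by (rule borel_integrable_atLeastAtMost') (rule continuous_on_tent)
  then show "integrable lborel tent"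
    by (simp add: set_integrable_def tent_indicator)
  have "(\<integral>z. indicator {0..1} z *\<^sub>R tent z \<partial>lborel) = c1_step 1 - c1_step 0"
    by (rule integral_FTC_atLeastAtMost)
      (auto intro!: continuous_on_tent DERIV_subset[OF DERIV_c1_step]
        simp: has_real_derivative_iff_has_vector_derivative[symmetric])
  then show "(\<integral>z. tent z \<partial>lborel) = 1"
    by (simp add: tent_indicator c1_step_le_0 c1_step_ge_1)
qed

section \<open>From weak derivatives to increments\<close>

text \<open>The rescaled tents are an approximate identity supported to the right of
  \<open>r\<close>, which is why a right limit of \<open>Y\<close> suffices. Rescaling moves the
  parameter into the argument of \<open>Y\<close>, and dominated convergence applies.\<close>

lemma tendsto_integral_tent:
  fixes Y :: "real \<Rightarrow> real"
  assumes Y[measurable]: "Y \<in> borel_measurable borel" and M: "\<And>x. \<bar>Y x\<bar> \<le> M"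
    and lim: "(Y \<longlongrightarrow> Y r) (at_right r)" and e: "e \<longlonglongrightarrow> 0" "\<And>n. e n > 0"
  shows "(\<lambda>n. \<integral>x. Y x * (tent ((x - r) / e n) / e n) \<partial>lborel) \<longlonglongrightarrow> Y r"
    and "integrable lborel (\<lambda>x. Y x * (tent ((x - r) / e n) / e n))"
proof -
  have tm[measurable]: "tent \<in> borel_measurable borel"
    by (intro borel_measurable_continuous_onI continuous_on_tent)
  show "integrable lborel (\<lambda>x. Y x * (tent ((x - r) / e n) / e n))"
  proof (rule Bochner_Integration.integrable_bound)
    have "integrable lborel (\<lambda>x. tent ((- r / e n) + (1 / e n) * x))"
      using e(2)[of n] by (intro lborel_integrable_real_affine integral_tent) simp
    then show "integrable lborel (\<lambda>x. (M / e n) * tent ((- r / e n) + (1 / e n) * x))"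
      by (rule integrable_mult_right)
    have "M \<ge> 0" using M[of 0] by linarith
    moreover have "- r / e n + 1 / e n * x = (x - r) / e n" for x by (simp add: diff_divide_distrib)
    ultimately show "AE x in lborel. norm (Y x * (tent ((x - r) / e n) / e n))
        \<le> norm ((M / e n) * tent ((- r / e n) + (1 / e n) * x))"
      using M e(2)[of n] by (auto simp: abs_mult tent_nonneg intro!: AE_I2 mult_right_mono divide_right_mono)
  qed simp
  have eq: "(\<integral>x. Y x * (tent ((x - r) / e n) / e n) \<partial>lborel) = (\<integral>z. Y (r + e n * z) * tent z \<partial>lborel)" for n
  proof -
    have "(\<integral>x. Y x * (tent ((x - r) / e n) / e n) \<partial>lborel)
        = e n * (\<integral>z. Y (r + e n * z) * tent z / e n \<partial>lborel)"
      using e(2)[of n] by (subst lborel_integral_real_affine[of "e n" _ r]) simp_all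
    then show ?thesis using e(2)[of n] by simp
  qed
  have "(\<lambda>n. \<integral>z. Y (r + e n * z) * tent z \<partial>lborel) \<longlonglongrightarrow> (\<integral>z. Y r * tent z \<partial>lborel)"
  proof (rule integral_dominated_convergence[where w = "\<lambda>z. M * tent z"])
    show "AE z in lborel. norm (Y (r + e n * z) * tent z) \<le> M * tent z" for n
      using M by (auto simp: abs_mult tent_nonneg intro!: AE_I2 mult_right_mono)
    show "AE z in lborel. (\<lambda>n. Y (r + e n * z) * tent z) \<longlonglongrightarrow> Y r * tent z"
    proof (intro AE_I2)
      fix z
      show "(\<lambda>n. Y (r + e n * z) * tent z) \<longlonglongrightarrow> Y r * tent z"
      proof (cases "z > 0")
        case True
        have "(\<lambda>n. r + e n * z) \<longlonglongrightarrow> r + 0 * z" by (intro tendsto_intros e)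
        then have "filterlim (\<lambda>n. r + e n * z) (at_right r) sequentially"
          using True e(2) by (auto simp: filterlim_at less_imp_neq[OF e(2), symmetric] intro!: always_eventually)
        then have "(\<lambda>n. Y (r + e n * z)) \<longlonglongrightarrow> Y r"
          by (rule filterlim_compose[OF lim])
        then show ?thesis by (intro tendsto_intros)
      qed (simp add: tent_eq_0)
    qed
  qed (use integral_tent in auto)
  then show "(\<lambda>n. \<integral>x. Y x * (tent ((x - r) / e n) / e n) \<partial>lborel) \<longlonglongrightarrow> Y r"
    by (simp only: eq integral_tent Bochner_Integration.integral_mult_right_zero mult_1_right)
qed

lemma deriv_zero_outside_closed:
  fixes \<phi> :: "real \<Rightarrow> real"
  assumes "closed K" "\<And>x. x \<notin> K \<Longrightarrow> \<phi> x = 0" "x \<notin> K"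
  shows "deriv \<phi> x = 0"
proof -
  have "\<forall>\<^sub>F z in nhds x. \<phi> z = 0"
    using assms by (intro eventually_mono[OF eventually_nhds_in_open[of "- K"]]) auto
  then have "deriv \<phi> x = deriv (\<lambda>_. 0) x" by (rule deriv_cong_ev) simp
  then show ?thesis by simp
qed

text \<open>The test functions step up just after \<open>s\<close> and down just after
  \<open>t\<close>. They tend to the indicator of the interval, and their derivatives to the
  difference of point masses at \<open>s\<close> and \<open>t\<close>.\<close>

lemma weak_deriv_integral:
  fixes y g :: "real \<Rightarrow> real"
  assumes S: "open S" and y: "continuous_on S y" and w: "has_weak_deriv S y g"
    and st: "s < t" "{s..t} \<subseteq> S"
  shows "(LBINT x:{s..t}. g x) = y t - y s" and "set_integrable lborel {s..t} g"
proof -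
  show "set_integrable lborel {s..t} g"
    using w st by (auto simp: has_weak_deriv_def locally_integrable_def)
  \<comment> \<open>The downward step lies to the right of \<open>t\<close>, so the supports need
    room there; on the left they start at \<open>s\<close>.\<close>
  obtain d where d: "d > 0" "{s..t+d} \<subseteq> S"
  proof -
    have "t \<in> S" using st by auto
    then obtain d where d: "d > 0" "cball t d \<subseteq> S" using S by (auto simp: open_contains_cball)
    have "{s..t+d} \<subseteq> {s..t} \<union> cball t d" by (auto simp: cball_eq_atLeastAtMost)
    with d st that show ?thesis by blast
  qed
  define I where "I = {s..t+d}"
  have I: "compact I" "I \<subseteq> S" using d by (auto simp: I_def)
  define e where "e n = d / Suc n" for n
  have e: "e \<longlonglongrightarrow> 0" "\<And>n. e n > 0" "\<And>n. e n \<le> d"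
    using d LIMSEQ_Suc[OF lim_const_over_n[of d]] unfolding e_def[abs_def] by (auto simp: field_simps)
  \<comment> \<open>Cutting \<open>y\<close> off outside \<open>I\<close> makes it bounded and
    measurable on the whole line, as the tent limit requires.\<close>
  define Y where "Y x = indicator I x * y x" for x
  have Ym: "Y \<in> borel_measurable borel"
    using borel_measurable_continuous_on_indicator[of I y] I continuous_on_subset[OF y]
    by (simp add: Y_def[abs_def] I_def)
  have "compact (y ` I)" using I by (intro compact_continuous_image continuous_on_subset[OF y])
  then obtain M where M0: "\<And>x. x \<in> I \<Longrightarrow> \<bar>y x\<bar> \<le> M"
    by (force dest!: compact_imp_bounded simp: bounded_iff)
  have "s \<in> I" using d st by (auto simp: I_def)
  then have M: "\<bar>Y x\<bar> \<le> M" for x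
    using M0[of x] M0[of s] by (auto simp: Y_def indicator_def)
  have lim: "(Y \<longlongrightarrow> Y r) (at_right r)" and Yr: "Y r = y r" if r: "r = s \<or> r = t" for r
  proof -
    show Yr: "Y r = y r" using r d st by (auto simp: Y_def I_def)
    have "isCont y r"
      by (rule continuous_on_interior[OF y]) (use r st in \<open>auto simp: interior_open[OF S]\<close>)
    then have "(y \<longlongrightarrow> y r) (at_right r)"
      by (simp add: continuous_at filterlim_at_split)
    moreover have "\<forall>\<^sub>F x in at_right r. y x = Y x"
      using r d st by (intro eventually_at_rightI[of r "t + d"]) (auto simp: Y_def I_def)
    ultimately show "(Y \<longlongrightarrow> Y r) (at_right r)"
      unfolding Yr by (rule Lim_transform_eventually)
  qed
  define \<phi> where "\<phi> n x = c1_step ((x - s) / e n) - c1_step ((x - t) / e n)" for n x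
  define \<phi>' where "\<phi>' n x = tent ((x - s) / e n) / e n - tent ((x - t) / e n) / e n" for n x
  have D: "(\<phi> n has_real_derivative \<phi>' n x) (at x)" for n x
  proof -
    have "((\<lambda>x. c1_step ((x - r) / e n)) has_real_derivative tent ((x - r) / e n) * (1 / e n)) (at x)" for r
      by (rule DERIV_chain2[OF DERIV_c1_step]) (use e(2)[of n] in \<open>auto intro!: derivative_eq_intros\<close>)
    then show ?thesis unfolding \<phi>_def[abs_def] \<phi>'_def
      by (auto intro!: DERIV_diff)
  qed
  have zero: "\<phi> n x = 0" "\<phi>' n x = 0" if x: "x \<notin> I" for n x
  proof -
    consider "x < s" | "x > t + d" using x by (force simp: I_def)
    then have "\<phi> n x = 0 \<and> \<phi>' n x = 0"
    proof cases
      case 1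
      then have "(x - s) / e n \<le> 0" "(x - t) / e n \<le> 0"
        using st e(2)[of n] by (auto simp: divide_le_0_iff)
      then show ?thesis by (simp add: \<phi>_def \<phi>'_def c1_step_le_0 tent_eq_0)
    next
      case 2
      then have "1 \<le> (x - s) / e n" "1 \<le> (x - t) / e n"
        using st e(2,3)[of n] by (auto simp: le_divide_eq)
      then show ?thesis by (simp add: \<phi>_def \<phi>'_def c1_step_ge_1 tent_eq_0)
    qed
    then show "\<phi> n x = 0" "\<phi>' n x = 0" by auto
  qed
  have test: "\<phi> n \<in> test_functions S" for n
  proof -
    have "continuous_on UNIV (\<phi>' n)"
      unfolding \<phi>'_def[abs_def]
      by (intro continuous_on_diff continuous_on_divide continuous_on_compose2[OF continuous_on_tent]
          continuous_intros) (use e(2)[of n] in auto)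
    then have "\<phi> n C1_differentiable_on UNIV"
      using D unfolding C1_differentiable_on_def has_real_derivative_iff_has_vector_derivative by blast
    then show ?thesis using I zero by (auto simp: test_functions_def)
  qed
  have d\<phi>: "deriv (\<phi> n) = \<phi>' n" for n
    using D by (intro ext DERIV_imp_deriv)
  have weq: "(LBINT x:S. y x * \<phi>' n x) = - (LBINT x:S. g x * \<phi> n x)" for n
    using w test[of n] unfolding has_weak_deriv_def d\<phi>[symmetric] by blast
  have L: "(LBINT x:S. y x * \<phi>' n x) = (\<integral>x. Y x * (tent ((x - s) / e n) / e n) \<partial>lborel)
     - (\<integral>x. Y x * (tent ((x - t) / e n) / e n) \<partial>lborel)" for n
  proof -
    have "(LBINT x:S. y x * \<phi>' n x) = (\<integral>x. Y x * (tent ((x - s) / e n) / e n)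
        - Y x * (tent ((x - t) / e n) / e n) \<partial>lborel)"
      unfolding set_lebesgue_integral_def
    proof (intro Bochner_Integration.integral_cong refl)
      fix x
      show "indicator S x *\<^sub>R (y x * \<phi>' n x) = Y x * (tent ((x - s) / e n) / e n)
        - Y x * (tent ((x - t) / e n) / e n)"
      proof (cases "x \<in> I")
        case True
        then show ?thesis using I by (auto simp: Y_def \<phi>'_def indicator_def algebra_simps)
      next
        case False
        then show ?thesis using zero[of x n] by (simp add: Y_def)
      qed
    qed
    also have "\<dots> = (\<integral>x. Y x * (tent ((x - s) / e n) / e n) \<partial>lborel)
     - (\<integral>x. Y x * (tent ((x - t) / e n) / e n) \<partial>lborel)"
      by (intro Bochner_Integration.integral_diff tendsto_integral_tent[OF Ym M lim e(1,2)]) auto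
    finally show ?thesis .
  qed
  have gI: "integrable lborel (\<lambda>x. indicator I x * g x)"
    using w I by (auto simp: has_weak_deriv_def locally_integrable_def set_integrable_def)
  have R: "(\<lambda>n. LBINT x:S. g x * \<phi> n x) \<longlonglongrightarrow> (LBINT x:{s..t}. g x)"
  proof -
    have eq: "(LBINT x:S. g x * \<phi> n x) = (\<integral>x. indicator I x * g x * \<phi> n x \<partial>lborel)" for n
      unfolding set_lebesgue_integral_def
      by (intro Bochner_Integration.integral_cong refl) (use I zero[of _ n] in \<open>auto simp: indicator_def\<close>)
    have [measurable]: "\<phi> n \<in> borel_measurable borel" for n
      by (intro borel_measurable_continuous_onI DERIV_continuous_on[OF D])
    have gm[measurable]: "(\<lambda>x. indicator I x * g x) \<in> borel_measurable borel" using gI by auto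
    have "(\<lambda>n. \<integral>x. indicator I x * g x * \<phi> n x \<partial>lborel)
        \<longlonglongrightarrow> (\<integral>x. indicator I x * g x * indicator {s..t} x \<partial>lborel)"
    proof (rule integral_dominated_convergence[where w = "\<lambda>x. \<bar>indicator I x * g x\<bar>"])
      show "AE x in lborel. norm (indicator I x * g x * \<phi> n x) \<le> \<bar>indicator I x * g x\<bar>" for n
      proof (intro AE_I2)
        fix x
        have "\<bar>\<phi> n x\<bar> \<le> 1"
          using c1_step_bounds[of "(x - s) / e n"] c1_step_bounds[of "(x - t) / e n"]
          by (simp add: \<phi>_def)
        then show "norm (indicator I x * g x * \<phi> n x) \<le> \<bar>indicator I x * g x\<bar>"
          using mult_left_mono[of "\<bar>\<phi> n x\<bar>" 1 "\<bar>indicator I x * g x\<bar>"] by (simp add: abs_mult)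
      qed
      \<comment> \<open>Every \<open>\<phi> n\<close> vanishes at \<open>s\<close>, so the pointwise
        limit is the indicator of \<open>{s<..t}\<close>; the endpoint \<open>s\<close> is a null
        set.\<close>
      show "AE x in lborel. (\<lambda>n. indicator I x * g x * \<phi> n x) \<longlonglongrightarrow> indicator I x * g x * indicator {s..t} x"
        using AE_lborel_singleton[of s]
      proof eventually_elim
        fix x assume x: "x \<noteq> s"
        have st_lim: "(\<lambda>n. c1_step ((x - r) / e n)) \<longlonglongrightarrow> indicator {r<..} x" for r
        proof (cases "x > r")
          case True
          have "\<forall>\<^sub>F n in sequentially. e n < x - r"
            using order_tendstoD(2)[OF e(1), of "x - r"] True by simp
          then have "\<forall>\<^sub>F n in sequentially. c1_step ((x - r) / e n) = indicator {r<..} x"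
          proof eventually_elim
            case (elim n)
            then have "1 \<le> (x - r) / e n" using e(2)[of n] by (simp add: le_divide_eq)
            then show ?case using True by (simp add: c1_step_ge_1)
          qed
          then show ?thesis by (rule tendsto_eventually)
        next
          case False
          then have "(x - r) / e n \<le> 0" for n using e(2)[of n] by (simp add: divide_le_0_iff)
          then show ?thesis using False by (simp add: c1_step_le_0)
        qed
        have "(\<lambda>n. indicator I x * g x * \<phi> n x) \<longlonglongrightarrow> indicator I x * g x * (indicator {s<..} x - indicator {t<..} x)"
          unfolding \<phi>_def by (intro tendsto_intros st_lim)
        also have "indicator {s<..} x - indicator {t<..} x = (indicator {s..t} x :: real)"
          using x st by (auto simp: indicator_def)
        finally show "(\<lambda>n. indicator I x * g x * \<phi> n x) \<longlonglongrightarrow> indicator I x * g x * indicator {s..t} x" .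
      qed
    qed (use gI in auto)
    moreover have "(\<integral>x. indicator I x * g x * indicator {s..t} x \<partial>lborel) = (LBINT x:{s..t}. g x)"
      unfolding set_lebesgue_integral_def
      by (intro Bochner_Integration.integral_cong refl) (use d in \<open>auto simp: indicator_def I_def\<close>)
    ultimately show ?thesis by (simp add: eq)
  qed
  have "(\<lambda>n. LBINT x:S. y x * \<phi>' n x) \<longlonglongrightarrow> Y s - Y t"
    unfolding L by (intro tendsto_diff tendsto_integral_tent[OF Ym M lim e(1,2)]) auto
  moreover have "(\<lambda>n. LBINT x:S. y x * \<phi>' n x) \<longlonglongrightarrow> - (LBINT x:{s..t}. g x)"
    unfolding weq by (intro tendsto_minus R)
  ultimately have "- (LBINT x:{s..t}. g x) = Y s - Y t"
    by (metis LIMSEQ_unique)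
  then show "(LBINT x:{s..t}. g x) = y t - y s" by (simp add: Yr)
qed

text \<open>On a bounded interval \<open>1 + (g x)\<^sup>2\<close> is an integrable majorant of
  \<open>g\<close>.\<close>

lemma L2_imp_set_integrable:
  assumes "g \<in> L2 {0<..<b}"
  shows "set_integrable lborel {0<..<b} g"
proof (rule set_integrable_bound)
  have "set_integrable lborel {0<..<b} (\<lambda>_. 1 :: real)"
    by (rule set_integrable_subset[OF borel_integrable_atLeastAtMost'[of 0 b]]) auto
  then show "set_integrable lborel {0<..<b} (\<lambda>x. 1 + (g x)\<^sup>2)"
    using assms by (intro set_integral_add) (auto simp: L2_def)
  show "set_borel_measurable lborel {0<..<b} g" using assms by (simp add: L2_def)
  have "\<bar>r\<bar> \<le> 1 + r\<^sup>2" for r :: real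
    using zero_le_power2[of "\<bar>r\<bar> - 1"] by (simp add: power2_diff)
  then show "AE x in lborel. x \<in> {0<..<b} \<longrightarrow> norm (g x) \<le> norm (1 + (g x)\<^sup>2)"
    by (intro AE_I2) (simp add: abs_of_nonneg)
qed

section \<open>Uniqueness, gluing and the boundary value at 0\<close>

text \<open>On every closed interval in \<open>T\<close> both functions integrate to the increment
  of \<open>y\<close>.\<close>

lemma weak_deriv_unique:
  fixes y g h :: "real \<Rightarrow> real"
  assumes "open S" "open T" "T \<subseteq> S" "continuous_on S y" "has_weak_deriv S y g" "has_weak_deriv T y h"
  shows "AE x in lborel. x \<in> T \<longrightarrow> g x = h x"
proof -
  have "AE x in lborel. x \<in> T \<longrightarrow> g x - h x = 0"
  proof (rule AE_zero_on_open_if_interval_integrals_zero)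
    fix s t assume st: "s < t" "{s..t} \<subseteq> T"
    note g = weak_deriv_integral[OF assms(1,4,5) st(1) order_trans[OF st(2) assms(3)]]
    note h = weak_deriv_integral[OF assms(2) continuous_on_subset[OF assms(4,3)] assms(6) st]
    show "set_integrable lborel {s..t} (\<lambda>x. g x - h x)" "(LBINT x:{s..t}. g x - h x) = 0"
      using g h by auto
  qed fact
  then show ?thesis by simp
qed

lemma compact_subset_bounded_interval:
  assumes "compact K" "K \<subseteq> {0<..}"
  obtains n :: nat where "K \<subseteq> {0<..<real (Suc n)}"
proof -
  obtain b where b: "\<And>x. x \<in> K \<Longrightarrow> \<bar>x\<bar> \<le> b"
    using compact_imp_bounded[OF assms(1)] by (auto simp: bounded_iff)
  obtain n where "b < real n" using reals_Archimedean2 by blast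
  then have "K \<subseteq> {0<..<real (Suc n)}" using b assms(2) by fastforce
  then show thesis by (rule that)
qed

text \<open>Weak derivatives on the bounded intervals agree almost everywhere on overlaps, so they
  can be glued; each test function on the half line lives in one of these intervals.\<close>

lemma ex_weak_deriv_halfline:
  fixes y :: "real \<Rightarrow> real"
  assumes y: "continuous_on {0<..} y" and H: "\<And>b. b > 0 \<Longrightarrow> y \<in> H1 {0<..<b}"
  shows "\<exists>g. has_weak_deriv {0<..} y g"
proof -
  have "\<exists>g. g \<in> L2 {0<..<real (Suc n)} \<and> has_weak_deriv {0<..<real (Suc n)} y g" for n
    using H[of "real (Suc n)"] by (auto simp: H1_def)
  then obtain G where GL: "\<And>n. G n \<in> L2 {0<..<real (Suc n)}"
    and GW: "\<And>n. has_weak_deriv {0<..<real (Suc n)} y (G n)" by metis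
  \<comment> \<open>A positive \<open>x\<close> lies below
    \<open>nat \<lfloor>x\<rfloor> + 1\<close>, so the chosen \<open>G\<close> is valid at
    \<open>x\<close>. The indicator is there because \<open>G n\<close> is known to be measurable
    only on its own interval.\<close>
  define g where "g x = indicator {0<..<real (Suc (nat \<lfloor>x\<rfloor>))} x * G (nat \<lfloor>x\<rfloor>) x" for x
  have Gm: "(\<lambda>x. indicator {0<..<real (Suc n)} x * G n x) \<in> borel_measurable borel" for n
    using GL[of n] by (simp add: L2_def set_borel_measurable_def)
  have gm[measurable]: "g \<in> borel_measurable borel"
    unfolding g_def
    by (rule measurable_compose_countable[where f = "\<lambda>n x. indicator {0<..<real (Suc n)} x * G n x", OF Gm])
      measurable
  have yn: "continuous_on {0<..<real (Suc n)} y" for n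
    by (rule continuous_on_subset[OF y]) auto
  have "AE x in lborel. x \<in> {0<..<real (Suc m)} \<longrightarrow> m \<le> n \<longrightarrow> G m x = G n x" for m n
  proof (cases "m \<le> n")
    case True
    have "AE x in lborel. x \<in> {0<..<real (Suc m)} \<longrightarrow> G n x = G m x"
      by (rule weak_deriv_unique[OF _ _ _ yn GW GW]) (use True in auto)
    then show ?thesis by eventually_elim auto
  qed simp
  then have "AE x in lborel. \<forall>m n. x \<in> {0<..<real (Suc m)} \<longrightarrow> m \<le> n \<longrightarrow> G m x = G n x"
    unfolding AE_all_countable by blast
  then have gG: "AE x in lborel. \<forall>n. x \<in> {0<..<real (Suc n)} \<longrightarrow> g x = G n x"
  proof eventually_elim
    case (elim x)
    show ?case
    proof (intro allI impI)
      fix n assume x: "x \<in> {0<..<real (Suc n)}"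
      then have "x \<in> {0<..<real (Suc (nat \<lfloor>x\<rfloor>))}" "nat \<lfloor>x\<rfloor> \<le> n"
        by (auto simp: nat_le_iff floor_le_iff) linarith
      moreover from this have "G (nat \<lfloor>x\<rfloor>) x = G n x" using elim by blast
      ultimately show "g x = G n x" by (simp add: g_def del: of_nat_Suc)
    qed
  qed
  have eq: "(LBINT x:K. g x * f x) = (LBINT x:K. G n x * f x)"
      "set_integrable lborel K g \<longleftrightarrow> set_integrable lborel K (G n)"
    if K: "K \<in> sets borel" "K \<subseteq> {0<..<real (Suc n)}" and f[measurable]: "f \<in> borel_measurable borel"
    for K n and f :: "real \<Rightarrow> real"
  proof -
    note [measurable] = K(1)
    have m: "(\<lambda>x. indicator K x * G n x) \<in> borel_measurable borel"
    proof -
      have "(\<lambda>x. indicator K x * (indicator {0<..<real (Suc n)} x * G n x)) \<in> borel_measurable borel"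
        using Gm[of n] by measurable
      also have "(\<lambda>x. indicator K x * (indicator {0<..<real (Suc n)} x * G n x)) = (\<lambda>x. indicator K x * G n x)"
        using K(2) by (auto simp: indicator_def fun_eq_iff)
      finally show ?thesis .
    qed
    have ae: "AE x in lborel. indicator K x * g x = indicator K x * G n x"
      using gG by eventually_elim (use K in \<open>auto simp: indicator_def\<close>)
    show "set_integrable lborel K g \<longleftrightarrow> set_integrable lborel K (G n)"
      unfolding set_integrable_def real_scaleR_def
      by (rule integrable_cong_AE) (use m ae in auto)
    have "(\<integral>x. indicator K x * g x * f x \<partial>lborel) = (\<integral>x. indicator K x * G n x * f x \<partial>lborel)"
      by (rule integral_cong_AE) (use m ae in auto)
    then show "(LBINT x:K. g x * f x) = (LBINT x:K. G n x * f x)"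
      by (simp add: set_lebesgue_integral_def mult.assoc)
  qed
  have "has_weak_deriv {0<..} y g"
    unfolding has_weak_deriv_def
  proof (intro conjI ballI)
    show "locally_integrable {0<..} y"
      unfolding locally_integrable_def set_integrable_def
      using borel_integrable_compact continuous_on_subset[OF y] by blast
    show "locally_integrable {0<..} g"
      unfolding locally_integrable_def
    proof (intro allI impI)
      fix K :: "real set" assume K: "compact K \<and> K \<subseteq> {0<..}"
      then obtain n where n: "K \<subseteq> {0<..<real (Suc n)}" by (auto elim: compact_subset_bounded_interval)
      have "set_integrable lborel K (G n)"
        using GW[of n] K n by (simp add: has_weak_deriv_def locally_integrable_def)
      then show "set_integrable lborel K g"
        using eq(2)[OF _ n, of "\<lambda>_. 0"] K by (auto simp: borel_compact)
    qed
    fix \<phi> assume \<phi>: "\<phi> \<in> test_functions {0<..}"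
    then obtain K where K: "compact K" "K \<subseteq> {0<..}" "\<And>x. x \<notin> K \<Longrightarrow> \<phi> x = 0"
      and C1: "\<phi> C1_differentiable_on UNIV"
      by (auto simp: test_functions_def)
    obtain n where n: "K \<subseteq> {0<..<real (Suc n)}" using compact_subset_bounded_interval[OF K(1,2)] .
    have dz: "deriv \<phi> x = 0" if "x \<notin> K" for x
      by (rule deriv_zero_outside_closed[OF _ K(3) that]) (use K in \<open>auto intro: compact_imp_closed\<close>)
    have \<phi>m: "\<phi> \<in> borel_measurable borel"
      using C1 by (intro borel_measurable_continuous_onI C1_differentiable_imp_continuous_on)
    have restr: "(LBINT x:{0<..}. f x * h x) = (LBINT x:{0<..<real (Suc n)}. f x * h x)"
      if "\<And>x. x \<notin> K \<Longrightarrow> h x = 0" for f h :: "real \<Rightarrow> real"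
      unfolding set_lebesgue_integral_def
    proof (intro Bochner_Integration.integral_cong refl)
      fix x
      show "indicator {0<..} x *\<^sub>R (f x * h x) = indicator {0<..<real (Suc n)} x *\<^sub>R (f x * h x)"
        using that[of x] n by (cases "x \<in> K") (auto simp: indicator_def)
    qed
    have "\<phi> \<in> test_functions {0<..<real (Suc n)}"
      using K C1 n by (auto simp: test_functions_def)
    then have "(LBINT x:{0<..<real (Suc n)}. y x * deriv \<phi> x) = - (LBINT x:{0<..<real (Suc n)}. G n x * \<phi> x)"
      using GW[of n] by (simp add: has_weak_deriv_def)
    moreover have "(LBINT x:{0<..<real (Suc n)}. g x * \<phi> x) = (LBINT x:{0<..<real (Suc n)}. G n x * \<phi> x)"
      by (rule eq(1)[OF _ order_refl \<phi>m]) simp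
    moreover have "(LBINT x:{0<..}. y x * deriv \<phi> x) = (LBINT x:{0<..<real (Suc n)}. y x * deriv \<phi> x)"
      by (rule restr) (rule dz)
    moreover have "(LBINT x:{0<..}. g x * \<phi> x) = (LBINT x:{0<..<real (Suc n)}. g x * \<phi> x)"
      by (rule restr) (rule K(3))
    ultimately show "(LBINT x:{0<..}. y x * deriv \<phi> x) = - (LBINT x:{0<..}. g x * \<phi> x)"
      by simp
  qed
  then show ?thesis by blast
qed

text \<open>The chosen weak derivative agrees almost everywhere on \<open>{0<..<T}\<close> with a
  square integrable one, hence is integrable down to 0. So \<open>y\<close> differs from the
  continuous primitive of \<open>u\<close> by a constant, which must be the limit at 0.\<close>

lemma weak_deriv_halfline:
  fixes y :: "real \<Rightarrow> real"
  assumes y: "continuous_on {0<..} y" and H: "\<And>b. b > 0 \<Longrightarrow> y \<in> H1 {0<..<b}"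
  defines "u \<equiv> weak_deriv {0<..} y"
  shows "loc_int u"
    and "\<And>t. 0 < t \<Longrightarrow> y t = Lim (at_right 0) y + causal_conv (\<lambda>_. 1) u t"
proof -
  have w: "has_weak_deriv {0<..} y u"
    unfolding u_def weak_deriv_def by (rule someI_ex[OF ex_weak_deriv_halfline[OF y H]])
  show u: "loc_int u"
    unfolding loc_int_def
  proof
    fix T :: real
    show "set_integrable lborel {0<..<T} u"
    proof (cases "T > 0")
      case True
      obtain G where G: "G \<in> L2 {0<..<T}" "has_weak_deriv {0<..<T} y G"
        using H[OF True] by (auto simp: H1_def)
      have ae: "AE x in lborel. x \<in> {0<..<T} \<longrightarrow> u x = G x"
        by (rule weak_deriv_unique[OF _ _ _ y w G(2)]) auto
      \<comment> \<open>Integrability of \<open>u\<close> is given only on compact subsets of the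
        half line, so measurability on \<open>{0<..<T}\<close> is obtained by exhausting it with
        compact intervals.\<close>
      have um: "(\<lambda>x. indicator {0<..<T} x * u x) \<in> borel_measurable lborel"
      proof (rule borel_measurable_LIMSEQ_real)
        fix n :: nat
        have "{c..T - c} \<subseteq> {0<..}" if "c > 0" for c using that by auto
        from this[of "1 / real (Suc n)"]
        have "compact {1 / real (Suc n)..T - 1 / real (Suc n)}"
          "{1 / real (Suc n)..T - 1 / real (Suc n)} \<subseteq> {0<..}"
          by auto
        then have "set_integrable lborel {1 / real (Suc n)..T - 1 / real (Suc n)} u"
          using w by (auto simp: has_weak_deriv_def locally_integrable_def)
        then show "(\<lambda>x. indicator {1 / real (Suc n)..T - 1 / real (Suc n)} x * u x) \<in> borel_measurable lborel"
          by (auto simp: set_integrable_def)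
      next
        fix x :: real
        have *: "(\<lambda>n. 1 / real (Suc n)) \<longlonglongrightarrow> 0" by (rule LIMSEQ_Suc[OF lim_const_over_n])
        have "\<forall>\<^sub>F n in sequentially. (indicator {1 / real (Suc n)..T - 1 / real (Suc n)} x :: real) = indicator {0<..<T} x"
        proof (cases "x \<in> {0<..<T}")
          case True
          have "\<forall>\<^sub>F n in sequentially. 1 / real (Suc n) < min x (T - x)"
            by (rule order_tendstoD(2)[OF *]) (use True in auto)
          then show ?thesis by eventually_elim (use True in \<open>auto simp: indicator_def\<close>)
        next
          case False
          have "0 < 1 / real (Suc n)" for n by simp
          then have "x \<notin> {1 / real (Suc n)..T - 1 / real (Suc n)}" for n
            using False by (smt (verit, best) atLeastAtMost_iff greaterThanLessThan_iff)
          then show ?thesis using False by (intro always_eventually allI) (auto simp: indicator_def)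
        qed
        then show "(\<lambda>n. indicator {1 / real (Suc n)..T - 1 / real (Suc n)} x * u x)
            \<longlonglongrightarrow> indicator {0<..<T} x * u x"
          by (intro tendsto_mult tendsto_const tendsto_eventually)
      qed
      have Gi: "set_integrable lborel {0<..<T} G" by (rule L2_imp_set_integrable[OF G(1)])
      show ?thesis
        by (rule set_integrable_bound[OF Gi]) (use um ae in \<open>auto simp: set_borel_measurable_def\<close>)
    qed simp
  qed
  define C where "C = causal_conv (\<lambda>_. 1) u"
  have C: "continuous_on UNIV C"
    unfolding C_def by (rule continuous_on_causal_conv[OF continuous_on_const u])
  have diff: "y t - y s = C t - C s" if "0 < s" "s < t" for s t
  proof -
    have "{s..t} \<subseteq> {0<..}" using that by auto
    then show ?thesis
      using weak_deriv_integral(1)[OF _ y w that(2)] integral_eq_causal_conv_one_diff(1)[OF u that]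
      by (simp add: C_def)
  qed
  have rep: "y t = (y 1 - C 1) + C t" if "0 < t" for t
    using diff[of t 1] diff[of 1 t] that by (cases t "1 :: real" rule: linorder_cases) auto
  have "(C \<longlongrightarrow> C 0) (at_right 0)"
    using C by (auto simp: continuous_on_def intro: tendsto_within_subset)
  then have "((\<lambda>t. (y 1 - C 1) + C t) \<longlongrightarrow> (y 1 - C 1) + C 0) (at_right 0)"
    by (intro tendsto_intros)
  moreover have "C 0 = 0" by (simp add: C_def causal_conv_nonpos)
  moreover have "\<forall>\<^sub>F t in at_right 0. (y 1 - C 1) + C t = y t"
    using eventually_at_right_less[of 0] by eventually_elim (rule rep[symmetric])
  \<comment> \<open>\<open>Lim\<close> carries information only once convergence is shown; here it
    is inherited from the continuity of \<open>C\<close> at 0.\<close>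
  ultimately have lim: "(y \<longlongrightarrow> y 1 - C 1) (at_right 0)"
    by (auto intro: Lim_transform_eventually)
  then have L: "Lim (at_right 0) y = y 1 - C 1"
    by (intro tendsto_Lim) auto
  show "y t = Lim (at_right 0) y + causal_conv (\<lambda>_. 1) u t" if "0 < t" for t
    using rep[OF that] L by (simp add: C_def)
qed

subsection \<open>The equivalence\<close>

lemma ABC_eq_causal_conv:
  "ABC B \<alpha> y t = B \<alpha> / (1 - \<alpha>) * causal_conv (ml_kernel \<alpha> (\<alpha> / (1 - \<alpha>))) (weak_deriv {0<..} y) t"
  by (simp add: ABC_def causal_conv_def ml_kernel_def)

lemma caputo_eq_causal_conv:
  "caputo \<alpha> y t = causal_conv (rl_kernel (1 - \<alpha>)) (weak_deriv {0<..} y) t"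
  by (simp add: caputo_def RL_integral_def causal_conv_def rl_kernel_def mult.commute)

theorem theorem7:
  fixes B :: "real \<Rightarrow> real" and \<alpha> :: real
    and y :: "real \<Rightarrow> real" and F :: "real \<Rightarrow> real \<Rightarrow> real"
  assumes "0 < \<alpha>" and "\<alpha> < 1"
    and "B 0 = 1" and "B 1 = 1" and "B \<alpha> \<noteq> 0"
    and "continuous_on {0<..} y"
    and "\<And>b. b > 0 \<Longrightarrow> y \<in> H1 {0<..<b}"
    and "continuous_on {0<..} (\<lambda>t. F t (y t))"
    and "\<And>b. b > 0 \<Longrightarrow> (\<lambda>t. F t (y t)) \<in> H1 {0<..<b}"
  shows "(\<forall>t>0. ABC B \<alpha> y t = F t (y t)) \<longleftrightarrow>
    (AE t in lborel. t > 0 \<longrightarrow>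
      caputo \<alpha> y t =
        (1 - \<alpha>) / B \<alpha> * caputo \<alpha> (\<lambda>s. F s (y s)) t
        + \<alpha> / B \<alpha> * F t (y t)
        + (1 - \<alpha>) * t powr (-\<alpha>) / (B \<alpha> * Gamma (1 - \<alpha>))
            * Lim (at_right 0) (\<lambda>s. F s (y s)))"
proof -
  define f where "f t = F t (y t)" for t
  define u v where "u = weak_deriv {0<..} y" and "v = weak_deriv {0<..} f"
  define c l where "c = B \<alpha> / (1 - \<alpha>)" and "l = \<alpha> / (1 - \<alpha>)"
  have \<alpha>: "0 < \<alpha>" "\<alpha> < 1" by fact+
  have f: "continuous_on {0<..} f" "\<And>b. b > 0 \<Longrightarrow> f \<in> H1 {0<..<b}"
    using assms(8,9) by (simp_all add: f_def[abs_def])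
  have u: "loc_int u" unfolding u_def by (rule weak_deriv_halfline(1)[OF assms(6,7)])
  have v: "loc_int v" unfolding v_def by (rule weak_deriv_halfline(1)[OF f])
  have fv: "f t = Lim (at_right 0) f + causal_conv (\<lambda>_. 1) v t" if "0 < t" for t
    unfolding v_def by (rule weak_deriv_halfline(2)[OF f that])
  \<comment> \<open>The Mittag-Leffler kernel is continuous up to 0, so the ABC side is continuous
    although \<open>u\<close> is merely integrable. The Riemann-Liouville kernel is singular at 0,
    and the Caputo equation stays an almost everywhere statement.\<close>
  have K: "continuous_on {0<..} (\<lambda>t. c * causal_conv (ml_kernel \<alpha> l) u t)"
    by (intro continuous_on_mult continuous_on_const
        continuous_on_subset[OF continuous_on_causal_conv[OF continuous_on_ml_kernel[OF \<alpha>(1)] u]]) simp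
  have "(\<forall>t>0. ABC B \<alpha> y t = F t (y t)) \<longleftrightarrow> (\<forall>t>0. c * causal_conv (ml_kernel \<alpha> l) u t = f t)"
    by (simp add: ABC_eq_causal_conv c_def l_def u_def f_def)
  also have "\<dots> \<longleftrightarrow> (AE t in lborel. 0 < t \<longrightarrow> c * causal_conv (ml_kernel \<alpha> l) u t = f t)"
    using continuous_AE_eq_imp_eq[OF K f(1)] by auto
  also have "\<dots> \<longleftrightarrow> (AE t in lborel. 0 < t \<longrightarrow> c * causal_conv (rl_kernel (1 - \<alpha>)) u t
      = causal_conv (rl_kernel (1 - \<alpha>)) v t + l * f t + Lim (at_right 0) f * rl_kernel (1 - \<alpha>) t)"
    by (rule ABC_caputo_equivalence[OF \<alpha> u v fv])
  also have "\<dots> \<longleftrightarrow> (AE t in lborel. t > 0 \<longrightarrow>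
      caputo \<alpha> y t =
        (1 - \<alpha>) / B \<alpha> * caputo \<alpha> (\<lambda>s. F s (y s)) t
        + \<alpha> / B \<alpha> * F t (y t)
        + (1 - \<alpha>) * t powr (-\<alpha>) / (B \<alpha> * Gamma (1 - \<alpha>))
            * Lim (at_right 0) (\<lambda>s. F s (y s)))"
  proof (intro AE_cong imp_cong refl)
    fix t
    have "f = (\<lambda>s. F s (y s))" by (simp add: f_def[abs_def])
    moreover have "Gamma (1 - \<alpha>) \<noteq> 0" using Gamma_real_pos[of "1 - \<alpha>"] \<alpha> by linarith
    \<comment> \<open>\<open>U\<close> and \<open>V\<close> stand for the Caputo derivatives of
      \<open>y\<close> and \<open>f\<close>, \<open>w\<close> for \<open>f t\<close>,
      \<open>L\<close> for the limit at 0, \<open>p / G\<close> for the kernel; multiplication by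
      the nonzero \<open>c\<close> links the two forms.\<close>
    moreover have "c * U = V + l * w + L * (p / G) \<longleftrightarrow>
        U = (1 - \<alpha>) / B \<alpha> * V + \<alpha> / B \<alpha> * w + (1 - \<alpha>) * p / (B \<alpha> * G) * L"
      if "G \<noteq> 0" for U V w L p G :: real
    proof -
      have "U = (1 - \<alpha>) / B \<alpha> * V + \<alpha> / B \<alpha> * w + (1 - \<alpha>) * p / (B \<alpha> * G) * L
        \<longleftrightarrow> c * U = c * ((1 - \<alpha>) / B \<alpha> * V + \<alpha> / B \<alpha> * w + (1 - \<alpha>) * p / (B \<alpha> * G) * L)"
        using assms(5) \<alpha> by (simp add: c_def)
      also have "c * ((1 - \<alpha>) / B \<alpha> * V + \<alpha> / B \<alpha> * w + (1 - \<alpha>) * p / (B \<alpha> * G) * L)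
        = V + l * w + L * (p / G)"
        using assms(5) \<alpha> that by (simp add: c_def l_def field_simps)
      finally show ?thesis by simp
    qed
    ultimately show "c * causal_conv (rl_kernel (1 - \<alpha>)) u t
      = causal_conv (rl_kernel (1 - \<alpha>)) v t + l * f t + Lim (at_right 0) f * rl_kernel (1 - \<alpha>) t \<longleftrightarrow>
      caputo \<alpha> y t =
        (1 - \<alpha>) / B \<alpha> * caputo \<alpha> (\<lambda>s. F s (y s)) t
        + \<alpha> / B \<alpha> * F t (y t)
        + (1 - \<alpha>) * t powr (-\<alpha>) / (B \<alpha> * Gamma (1 - \<alpha>))
            * Lim (at_right 0) (\<lambda>s. F s (y s))"
      by (simp add: caputo_eq_causal_conv u_def v_def rl_kernel_def)
  qed
  finally show ?thesis .
qed

end
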